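(* Let $G$ be a locally compact group. Then $G$ is isomorphic, as a topological group, to a scale group if and only if it satisfies the following three conditions: (1) $G$ has no non-trivial compact normal subgroup; (2) there is an open normal subgroup $H\triangleleft G$ such that $G/H\cong\mathbb{Z}$; and (3) (for the same $H$) there are a compact open subgroup $V\leq G$ and an element $x\in G$ such that $xVx^{-1}$ is a proper subgroup of $V$ and $\bigcup_{n\in\mathbb{Z}} x^nVx^{-n} = H$. Moreover, any $G$ satisfying (1)–(3) is isomorphic to a scale group in $\mathrm{Isom}(T_{q+1})_{\omega}$ with $q = \min\{s(y) \mid y\in G \text{ with } s(y)\neq 1\}$.
   Context: For an integer $q\ge2$, $T_{q+1}$ is the tree in which every vertex has $q+1$ neighbours, $\omega$ is a fixed end of it (an equivalence class of rays, two rays being equivalent if they share infinitely many vertices), $\mathrm{Isom}(T_{q+1})$ is its automorphism group with the topology of pointwise convergence on vertices, and $\mathrm{Isom}(T_{q+1})_\omega$ is the stabiliser of $\omega$. A scale group is a closed subgroup of $\mathrm{Isom}(T_{q+1})$ (for some $q\geq 2$) that fixes $\omega$ and is transitive on the vertices of $T_{q+1}$; it carries the subspace topology. For a totally disconnected, locally compact group $G$ and $y\in G$, the scale $s(y)$ is the minimum of the positive integers $[yUy^{-1}:yUy^{-1}\cap U]$ over all compact open subgroups $U\le G$. (A locally compact group satisfying (1)–(3) is totally disconnected.) *)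

theory Defs
  imports
    "HOL-Analysis.Analysis"
    "HOL-Algebra.Bij"
    "HOL-Algebra.Coset"
    "HOL-Algebra.Elementary_Groups"
begin

section \<open>Topological groups\<close>

definition topological_group :: "('a, 'm) monoid_scheme \<Rightarrow> 'a topology \<Rightarrow> bool" where
  "topological_group G T \<longleftrightarrow>
     group G \<and> topspace T = carrier G \<and>
     continuous_map (prod_topology T T) T (\<lambda>(x, y). x \<otimes>\<^bsub>G\<^esub> y) \<and>
     continuous_map T T (\<lambda>x. inv\<^bsub>G\<^esub> x)"

text \<open>As usual, locally compact groups are Hausdorff.\<close>

definition locally_compact_group :: "('a, 'm) monoid_scheme \<Rightarrow> 'a topology \<Rightarrow> bool" where
  "locally_compact_group G T \<longleftrightarrow>
     topological_group G T \<and> Hausdorff_space T \<and> locally_compact_space T"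

definition top_group_isomorphic ::
    "('a, 'm) monoid_scheme \<Rightarrow> 'a topology \<Rightarrow> ('b, 'n) monoid_scheme \<Rightarrow> 'b topology \<Rightarrow> bool" where
  "top_group_isomorphic G T G' T' \<longleftrightarrow> (\<exists>f. f \<in> iso G G' \<and> homeomorphic_map T T' f)"

definition compact_open_subgroup :: "('a, 'm) monoid_scheme \<Rightarrow> 'a topology \<Rightarrow> 'a set \<Rightarrow> bool" where
  "compact_open_subgroup G T U \<longleftrightarrow> subgroup U G \<and> compactin T U \<and> openin T U"

definition conj_set :: "('a, 'm) monoid_scheme \<Rightarrow> 'a \<Rightarrow> 'a set \<Rightarrow> 'a set" where
  "conj_set G x U = (\<lambda>u. x \<otimes>\<^bsub>G\<^esub> u \<otimes>\<^bsub>G\<^esub> inv\<^bsub>G\<^esub> x) ` U"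

text \<open>The index \<open>[A : B]\<close> of \<open>B\<close> in \<open>A\<close> (with value \<open>0\<close> if it is infinite, which does not
  occur for \<open>A\<close> compact and \<open>B\<close> open).\<close>

definition subgroup_index :: "('a, 'm) monoid_scheme \<Rightarrow> 'a set \<Rightarrow> 'a set \<Rightarrow> nat" where
  "subgroup_index G A B = card (rcosets\<^bsub>G\<lparr>carrier := A\<rparr>\<^esub> B)"

text \<open>The infimum in \<^typ>\<open>nat\<close> of a nonempty set is its minimum.\<close>

definition group_scale :: "('a, 'm) monoid_scheme \<Rightarrow> 'a topology \<Rightarrow> 'a \<Rightarrow> nat" where
  "group_scale G T y =
     Inf {subgroup_index G (conj_set G y U) (conj_set G y U \<inter> U) | U. compact_open_subgroup G T U}"


section \<open>Regular trees, ends and automorphisms\<close>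

text \<open>A simple graph is given by its vertex set \<open>V\<close> and its symmetric, irreflexive adjacency
  relation \<open>E\<close>.\<close>

definition simple_graph :: "'v set \<Rightarrow> 'v rel \<Rightarrow> bool" where
  "simple_graph V E \<longleftrightarrow> E \<subseteq> V \<times> V \<and> sym E \<and> irrefl E"

definition connected_graph :: "'v set \<Rightarrow> 'v rel \<Rightarrow> bool" where
  "connected_graph V E \<longleftrightarrow> V \<noteq> {} \<and> (\<forall>u\<in>V. \<forall>v\<in>V. (u, v) \<in> E\<^sup>*)"

definition is_cycle :: "'v rel \<Rightarrow> 'v list \<Rightarrow> bool" where
  "is_cycle E xs \<longleftrightarrow>
     3 \<le> length xs \<and> distinct xs \<and> successively (\<lambda>u v. (u, v) \<in> E) xs \<and> (last xs, hd xs) \<in> E"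

definition tree :: "'v set \<Rightarrow> 'v rel \<Rightarrow> bool" where
  "tree V E \<longleftrightarrow> simple_graph V E \<and> connected_graph V E \<and> (\<nexists>xs. is_cycle E xs)"

definition regular_tree :: "nat \<Rightarrow> 'v set \<Rightarrow> 'v rel \<Rightarrow> bool" where
  "regular_tree d V E \<longleftrightarrow>
     tree V E \<and> (\<forall>v\<in>V. finite {w. (v, w) \<in> E} \<and> card {w. (v, w) \<in> E} = d)"

definition rays :: "'v set \<Rightarrow> 'v rel \<Rightarrow> (nat \<Rightarrow> 'v) set" where
  "rays V E = {r. range r \<subseteq> V \<and> inj r \<and> (\<forall>i. (r i, r (Suc i)) \<in> E)}"

definition ray_equiv :: "'v set \<Rightarrow> 'v rel \<Rightarrow> (nat \<Rightarrow> 'v) rel" where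
  "ray_equiv V E = {(r, s). r \<in> rays V E \<and> s \<in> rays V E \<and> infinite (range r \<inter> range s)}"

definition ends :: "'v set \<Rightarrow> 'v rel \<Rightarrow> (nat \<Rightarrow> 'v) set set" where
  "ends V E = rays V E // ray_equiv V E"

text \<open>Automorphisms are represented by functions that are extensional on \<open>V\<close>, as in
  \<^const>\<open>BijGroup\<close>.\<close>

definition Isom :: "'v set \<Rightarrow> 'v rel \<Rightarrow> ('v \<Rightarrow> 'v) monoid" where
  "Isom V E = (BijGroup V)
     \<lparr>carrier := {g \<in> Bij V. \<forall>u\<in>V. \<forall>v\<in>V. (g u, g v) \<in> E \<longleftrightarrow> (u, v) \<in> E}\<rparr>"

text \<open>The topology of pointwise convergence on vertices: the trace of the product topology on
  functions from \<open>V\<close> to the discrete space \<open>V\<close>.\<close>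

definition Isom_topology :: "'v set \<Rightarrow> 'v rel \<Rightarrow> ('v \<Rightarrow> 'v) topology" where
  "Isom_topology V E =
     subtopology (product_topology (\<lambda>_. discrete_topology V) V) (carrier (Isom V E))"

definition Isom_end :: "'v set \<Rightarrow> 'v rel \<Rightarrow> (nat \<Rightarrow> 'v) set \<Rightarrow> ('v \<Rightarrow> 'v) set" where
  "Isom_end V E \<omega> = {g \<in> carrier (Isom V E). (\<lambda>r. g \<circ> r) ` \<omega> = \<omega>}"


section \<open>Scale groups\<close>

text \<open>\<open>P\<close> is a scale group in the stabiliser of the end \<open>\<omega>\<close> of the tree \<open>(V, E)\<close>.\<close>

definition scale_group :: "'v set \<Rightarrow> 'v rel \<Rightarrow> (nat \<Rightarrow> 'v) set \<Rightarrow> ('v \<Rightarrow> 'v) set \<Rightarrow> bool" where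
  "scale_group V E \<omega> P \<longleftrightarrow>
     subgroup P (Isom V E) \<and> closedin (Isom_topology V E) P \<and>
     P \<subseteq> Isom_end V E \<omega> \<and>
     (\<forall>u\<in>V. \<forall>v\<in>V. \<exists>g\<in>P. g u = v)"

definition isomorphic_to_scale_group ::
    "('a, 'm) monoid_scheme \<Rightarrow> 'a topology \<Rightarrow> 'v set \<Rightarrow> 'v rel \<Rightarrow> (nat \<Rightarrow> 'v) set \<Rightarrow> bool" where
  "isomorphic_to_scale_group G T V E \<omega> \<longleftrightarrow>
     (\<exists>P. scale_group V E \<omega> P \<and>
        top_group_isomorphic G T ((Isom V E)\<lparr>carrier := P\<rparr>) (subtopology (Isom_topology V E) P))"

definition no_compact_normal_subgroup :: "('a, 'm) monoid_scheme \<Rightarrow> 'a topology \<Rightarrow> bool" where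
  "no_compact_normal_subgroup G T \<longleftrightarrow> (\<forall>N. N \<lhd> G \<and> compactin T N \<longrightarrow> N = {\<one>\<^bsub>G\<^esub>})"

definition open_normal_with_quotient_Z ::
    "('a, 'm) monoid_scheme \<Rightarrow> 'a topology \<Rightarrow> 'a set \<Rightarrow> bool" where
  "open_normal_with_quotient_Z G T H \<longleftrightarrow> H \<lhd> G \<and> openin T H \<and> G Mod H \<cong> integer_group"

definition ascending_union_of_conjugates ::
    "('a, 'm) monoid_scheme \<Rightarrow> 'a topology \<Rightarrow> 'a set \<Rightarrow> bool" where
  "ascending_union_of_conjugates G T H \<longleftrightarrow>
     (\<exists>V x. compact_open_subgroup G T V \<and> x \<in> carrier G \<and> conj_set G x V \<subset> V \<and>
        (\<Union>n::int. conj_set G (x [^]\<^bsub>G\<^esub> n) V) = H)"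

definition scale_group_conditions :: "('a, 'm) monoid_scheme \<Rightarrow> 'a topology \<Rightarrow> bool" where
  "scale_group_conditions G T \<longleftrightarrow>
     no_compact_normal_subgroup G T \<and>
     (\<exists>H. open_normal_with_quotient_Z G T H \<and> ascending_union_of_conjugates G T H)"

end

theory Submission
  imports Defs "HOL-Algebra.Group_Action"
begin

text \<open>Moving every vertex one step towards \<open>\<omega>\<close> is a \<open>q\<close>-to-one map \<open>p\<close> that determines the tree together with its end:
  the stabiliser of \<open>\<omega>\<close> consists of the bijections that commute with \<open>p\<close>, and any two such maps with
  the same \<open>q\<close> are conjugate. So scale groups are the faithful, vertex-transitive actions commuting with such a
  map whose vertex stabilisers are compact and open. For such an action, \<open>H\<close> is the kernel of the level shift,
  \<open>V\<close> is the stabiliser of a vertex, and \<open>x\<close> moves that vertex to a child; a compact normal subgroup has finite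
  orbits, hence fixes a vertex, hence all of them.

  Conversely, conditions (1)--(3) yield a compact open \<open>W\<close> and a generator \<open>t\<close> of \<open>G/H\<close> with
  \<open>tWt\<inverse> \<subseteq> W\<close>. The tree is the set of cosets \<open>Wa\<close> with \<open>p (Wa) = Wta\<close>, so \<open>q = [W : tWt\<inverse>]\<close>, and \<open>G\<close> acts by
  right translation. The quotient of \<open>[yUy\<inverse> : yUy\<inverse> \<inter> U]\<close> by \<open>[U : yUy\<inverse> \<inter> U]\<close> is a homomorphism in \<open>y\<close> and does
  not depend on \<open>U\<close>; it is \<open>1\<close> on \<open>H\<close> and \<open>q\<close> at \<open>t\<inverse>\<close>. Hence \<open>s(t\<inverse>) = q\<close>, and every other scale is \<open>1\<close> or at least \<open>q\<close>.\<close>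

section \<open>Trees directed towards an end\<close>

text \<open>Each axiom of the tree of cosets comes from one of the conditions. The map taking
  \<open>Wa\<close> to \<open>Wta\<close> is well defined because \<open>t\<close> contracts
  \<open>W\<close>; it has no cycles because \<open>t\<close> has infinite order modulo
  \<open>H\<close>; any two vertices have a common ancestor because conjugation by powers of
  \<open>t\<close> eventually brings every element of \<open>H\<close> into \<open>W\<close>.
  Condition (1) is used twice: the kernel of the action is compact, hence trivial, and q = 1 would
  force \<open>H = W\<close>, so that \<open>H\<close> would be compact and normal.

  The lower bound for the scale must cover all compact open subgroups, not only vertex stabilisers.
  Hence the quotient of indices: it can be evaluated at \<open>W\<close>, while the minimum defining
  s(y) may be attained anywhere.

  Cosets and the vertices of the given tree have different types. The two directions therefore meet
  in an abstract notion of action, which records only \<open>p\<close> and the fact that the set of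
  group elements taking one vertex to another is compact and open.\<close>

text \<open>A regular tree with a distinguished end is encoded by the map \<open>p\<close> that moves every vertex one
  step towards the end.\<close>

locale parent_tree =
  fixes q :: nat and X :: "'v set" and p :: "'v \<Rightarrow> 'v"
  assumes nonempty: "X \<noteq> {}"
    and parent_closed: "v \<in> X \<Longrightarrow> p v \<in> X"
    and card_children: "v \<in> X \<Longrightarrow> card {u \<in> X. p u = v} = q"
    and q_ge2: "q \<ge> 2"
    and acyclic: "v \<in> X \<Longrightarrow> (p ^^ n) v = v \<Longrightarrow> n = 0"
    and merge: "u \<in> X \<Longrightarrow> v \<in> X \<Longrightarrow> \<exists>m n. (p ^^ m) u = (p ^^ n) v"
begin

lemma funpow_closed: "v \<in> X \<Longrightarrow> (p ^^ n) v \<in> X"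
  by (induction n) (auto simp: parent_closed)

lemma finite_children: "v \<in> X \<Longrightarrow> finite {u \<in> X. p u = v}"
  using card_children[of v] q_ge2 by (metis card.infinite not_numeral_le_zero)

lemma funpow_inj: 
  assumes "v \<in> X" "(p ^^ m) v = (p ^^ n) v" shows "m = n"
proof -
  have *: "a = b" if "a \<le> b" "(p ^^ a) v = (p ^^ b) v" for a b
  proof -
    have "(p ^^ (b - a)) ((p ^^ a) v) = (p ^^ a) v"
      using that by (metis comp_apply funpow_add le_add_diff_inverse2)
    then show ?thesis using acyclic[OF funpow_closed[OF assms(1)]] that(1) by force
  qed
  show ?thesis using *[of m n] *[of n m] assms(2) by (cases "m \<le> n") auto
qed

text \<open>Both halves are needed for compactness of transporters: finiteness bounds the possible
  images of a vertex, and the exact count turns injectivity into surjectivity.\<close>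

lemma descendants_finite_card:
  assumes "v \<in> X" shows "finite {u \<in> X. (p ^^ n) u = v} \<and> card {u \<in> X. (p ^^ n) u = v} = q ^ n"
  using assms
proof (induction n arbitrary: v)
  case 0
  then have "{u \<in> X. (p ^^ 0) u = v} = {v}" by auto
  then show ?case by simp
next
  case (Suc n)
  let ?D = "\<lambda>w. {u \<in> X. (p ^^ n) u = w}" and ?C = "{w \<in> X. p w = v}"
  have eq: "{u \<in> X. (p ^^ Suc n) u = v} = (\<Union>w\<in>?C. ?D w)"
    using funpow_closed by auto
  have fin: "finite ?C" using Suc.prems finite_children by auto
  have "card (\<Union>w\<in>?C. ?D w) = (\<Sum>w\<in>?C. card (?D w))"
    by (rule card_UN_disjoint) (use fin Suc.IH in auto)
  also have "\<dots> = (\<Sum>w\<in>?C. q ^ n)" using Suc.IH by (intro sum.cong) auto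
  also have "\<dots> = q ^ Suc n" using card_children[OF Suc.prems] by simp
  finally show ?case using eq fin Suc.IH by auto
qed

text \<open>This is the Busemann function of the end, with the sign that makes it grow towards the
  end. If \<open>v\<close> and \<open>x0\<close> meet after \<open>m\<close> and \<open>n\<close>
  steps, the value is \<open>n - m\<close>; two meeting points give the same difference, since
  otherwise some vertex would return to itself under \<open>p\<close>.\<close>

lemma level_exists:
  "\<exists>b :: 'v \<Rightarrow> int. (\<forall>v\<in>X. b (p v) = b v + 1) \<and> (\<forall>v\<in>X. \<forall>n. b ((p ^^ n) v) = b v + int n)"
proof -
  obtain x0 where x0: "x0 \<in> X" using nonempty by auto
  define b where "b v = (SOME z. \<exists>m n. (p ^^ m) v = (p ^^ n) x0 \<and> z = int n - int m)" for v
  have ex: "\<exists>m n. (p ^^ m) v = (p ^^ n) x0 \<and> b v = int n - int m" if "v \<in> X" for v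
    unfolding b_def by (rule someI_ex) (use merge[OF that x0] in blast)
  have uniq: "b v = int n - int m" if v: "v \<in> X" "(p ^^ m) v = (p ^^ n) x0" for v m n
  proof -
    obtain m' n' where *: "(p ^^ m') v = (p ^^ n') x0" "b v = int n' - int m'" using ex[OF v(1)] by blast
    have "(p ^^ (m' + n)) x0 = (p ^^ (m' + m)) v" by (simp add: funpow_add v(2))
    also have "\<dots> = (p ^^ (m + n')) x0" using *(1) by (metis add.commute comp_apply funpow_add)
    finally have "m' + n = m + n'" using funpow_inj[OF x0] by blast
    then show ?thesis using * by linarith
  qed
  have 1: "b (p v) = b v + 1" if v: "v \<in> X" for v
  proof -
    obtain m n where *: "(p ^^ m) v = (p ^^ n) x0" "b v = int n - int m" using ex[OF v] by blast
    have "(p ^^ m) (p v) = (p ^^ Suc n) x0" using *(1) by (metis funpow.simps(2) comp_apply funpow_swap1)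
    then show ?thesis using uniq[OF parent_closed[OF v]] *(2) by fastforce
  qed
  have "b ((p ^^ n) v) = b v + int n" if "v \<in> X" for v n
    by (induction n) (auto simp: 1 funpow_closed that)
  then show ?thesis using 1 by blast
qed

text \<open>Only differences of levels matter, so the additive constant left open by
  \<open>SOME\<close> is harmless.\<close>

definition level :: "'v \<Rightarrow> int" where
  "level = (SOME b. (\<forall>v\<in>X. b (p v) = b v + 1) \<and> (\<forall>v\<in>X. \<forall>n. b ((p ^^ n) v) = b v + int n))"

lemma level_parent: "v \<in> X \<Longrightarrow> level (p v) = level v + 1"
  and level_funpow: "v \<in> X \<Longrightarrow> level ((p ^^ n) v) = level v + int n"
  using someI_ex[OF level_exists] unfolding level_def by blast+

lemma merge_same_level:
  assumes "u \<in> X" "v \<in> X" "level u = level v" shows "\<exists>n. (p ^^ n) u = (p ^^ n) v"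
proof -
  obtain m n where *: "(p ^^ m) u = (p ^^ n) v" using merge assms by blast
  then have "m = n" using level_funpow[OF assms(1), of m] level_funpow[OF assms(2), of n] assms(3) by simp
  then show ?thesis using * by blast
qed

end

section \<open>The parent map of a regular tree with an end\<close>

text \<open>Among all repetitions one with the smallest gap is taken; a repetition inside its
  segment would have a smaller gap.\<close>

lemma first_repeat:
  fixes w :: "nat \<Rightarrow> 'v"
  assumes "\<not> inj_on w {..n}"
  shows "\<exists>i j. i < j \<and> j \<le> n \<and> w i = w j \<and> inj_on w {i..<j}"
proof -
  have "\<exists>d. \<exists>i. 0 < d \<and> i + d \<le> n \<and> w i = w (i + d)"
  proof -
    obtain a b where "a < b" "b \<le> n" "w a = w b"
      using assms unfolding inj_on_def by (metis atMost_iff linorder_neqE_nat)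
    then show ?thesis by (intro exI[of _ "b - a"] exI[of _ a]) auto
  qed
  then obtain d where d: "\<exists>i. 0 < d \<and> i + d \<le> n \<and> w i = w (i + d)"
    and min: "\<And>e. e < d \<Longrightarrow> \<not> (\<exists>i. 0 < e \<and> i + e \<le> n \<and> w i = w (i + e))"
    using exists_least_iff[of "\<lambda>d. \<exists>i. 0 < d \<and> i + d \<le> n \<and> w i = w (i + d)"] by blast
  then obtain i where i: "0 < d" "i + d \<le> n" "w i = w (i + d)" by blast
  have "False" if "a < b" "a \<in> {i..<i+d}" "b \<in> {i..<i+d}" "w a = w b" for a b
  proof -
    have "b - a < d" "0 < b - a" "a + (b - a) = b" "b \<le> n" using that i by auto
    then show False using min that(4) by metis
  qed
  then have "inj_on w {i..<i + d}" unfolding inj_on_def by (metis linorder_neqE_nat)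
  then show ?thesis using i by (intro exI[of _ i] exI[of _ "i + d"]) auto
qed

lemma nonbacktracking_inj:
  assumes tree: "tree V E"
    and walk: "\<And>i. i < n \<Longrightarrow> (w i, w (Suc i)) \<in> E"
    and nb: "\<And>i. Suc (Suc i) \<le> n \<Longrightarrow> w i \<noteq> w (Suc (Suc i))"
  shows "inj_on w {..n}"
proof (rule ccontr)
  assume "\<not> ?thesis"
  then obtain i j where ij: "i < j" "j \<le> n" "w i = w j" "inj_on w {i..<j}" using first_repeat by blast
  have irr: "irrefl E" using tree by (simp add: tree_def simple_graph_def)
  \<comment> \<open>A cycle needs length at least 3: gap 1 would be a loop, gap 2 would be
    backtracking.\<close>
  have "j \<noteq> Suc i" using walk[of i] irr ij by (auto simp: irrefl_def)
  moreover have "j \<noteq> Suc (Suc i)" using nb[of i] ij by auto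
  ultimately have j3: "i + 3 \<le> j" using ij(1) by linarith
  have "is_cycle E (map w [i..<j])"
    unfolding is_cycle_def
  proof (intro conjI)
    show "distinct (map w [i..<j])" using ij(4) by (simp add: distinct_map)
    show "successively (\<lambda>u v. (u, v) \<in> E) (map w [i..<j])"
      using walk ij by (auto simp: successively_conv_nth)
    have "last (map w [i..<j]) = w (j - 1)" using ij(1) by (simp add: last_map)
    moreover have "hd (map w [i..<j]) = w i" using ij(1) by (simp add: hd_map)
    ultimately show "(last (map w [i..<j]), hd (map w [i..<j])) \<in> E"
      using walk[of "j - 1"] ij by simp
  qed (use j3 in auto)
  then show False using tree unfolding tree_def by blast
qed

lemma rays_nonbacktracking:
  assumes "tree V E" "\<And>i. (r i, r (Suc i)) \<in> E" "\<And>i. r i \<noteq> r (Suc (Suc i))"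
  shows "r \<in> rays V E"
proof -
  have "inj_on r {..n}" for n using nonbacktracking_inj[OF assms(1)] assms(2,3) by blast
  then have "inj r" by (metis atMost_iff inj_on_def injI nle_le)
  moreover have "E \<subseteq> V \<times> V" using assms(1) by (simp add: tree_def simple_graph_def)
  ultimately show ?thesis using assms(2) unfolding rays_def by blast
qed

text \<open>If the rays met again, going back along \<open>s\<close> to the branching vertex and
  then out along \<open>r\<close> would be a closed walk without backtracking.\<close>

lemma rays_diverge:
  assumes tree: "tree V E" and r: "r \<in> rays V E" and s: "s \<in> rays V E"
    and meet: "r i = s j" and div: "r (Suc i) \<noteq> s (Suc j)"
  shows "r (Suc i + a) \<noteq> s (Suc j + b)"
proof
  assume eq: "r (Suc i + a) = s (Suc j + b)"
  \<comment> \<open>The walk starts at \<open>s (Suc j + b)\<close>, is at \<open>s j = r i\<close>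
    at time \<open>Suc b\<close>, and ends at \<open>r (Suc i + a)\<close>. The only turn is at time
    \<open>Suc b\<close>, where \<open>div\<close> excludes backtracking.\<close>
  define w where "w k = (if k \<le> Suc b then s (Suc j + b - k) else r (i + (k - Suc b)))" for k
  have sym: "sym E" using tree by (simp add: tree_def simple_graph_def)
  have inj: "inj r" "inj s" and edge: "\<And>i. (r i, r (Suc i)) \<in> E" "\<And>i. (s i, s (Suc i)) \<in> E"
    using r s by (auto simp: rays_def)
  have "inj_on w {..Suc b + Suc a}"
  proof (rule nonbacktracking_inj[OF tree])
    fix k assume k: "k < Suc b + Suc a"
    show "(w k, w (Suc k)) \<in> E"
    proof (cases "k < Suc b")
      case True
      then have "Suc j + b - k = Suc (Suc j + b - Suc k)" by linarith
      then show ?thesis using True edge(2) symD[OF sym] by (simp add: w_def)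
    next
      case False
      then have "w k = r (i + (k - Suc b))" using meet by (cases "k = Suc b") (auto simp: w_def)
      moreover have "w (Suc k) = r (Suc (i + (k - Suc b)))"
      proof -
        have "Suc k - Suc b = Suc (k - Suc b)" using False by linarith
        then show ?thesis using False unfolding w_def by (metis add_Suc_right Suc_less_eq linorder_not_less less_Suc_eq_le)
      qed
      ultimately show ?thesis using edge(1) by simp
    qed
  next
    fix k assume "Suc (Suc k) \<le> Suc b + Suc a"
    consider "Suc (Suc k) \<le> Suc b" | "k = b" | "k \<ge> Suc b" by linarith
    then show "w k \<noteq> w (Suc (Suc k))"
    proof cases
      case 1
      then have "Suc j + b - k \<noteq> Suc j + b - Suc (Suc k)" by linarith
      then show ?thesis using 1 inj(2) by (auto simp: w_def dest!: injD)
    next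
      case 2
      then show ?thesis using div by (simp add: w_def)
    next
      case 3
      then have "w k = r (i + (k - Suc b))" using meet by (cases "k = Suc b") (auto simp: w_def)
      then show ?thesis using 3 inj(1) by (auto simp: w_def dest!: injD)
    qed
  qed
  moreover have "w 0 = w (Suc b + Suc a)" using eq by (simp add: w_def)
  ultimately show False by (auto dest!: inj_onD)
qed

text \<open>Once the rays separate they stay disjoint, so all common vertices would lie on two
  finite initial segments. Consequently a ray of an end is determined by its first vertex.\<close>

lemma ray_equiv_agree:
  assumes tree: "tree V E" and eqv: "(r, s) \<in> ray_equiv V E" and meet: "r i = s j"
  shows "r (i + k) = s (j + k)"
proof (induction k)
  case (Suc k)
  have r: "r \<in> rays V E" and s: "s \<in> rays V E" and inf: "infinite (range r \<inter> range s)"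
    using eqv by (auto simp: ray_equiv_def)
  show ?case
  proof (rule ccontr)
    assume "r (i + Suc k) \<noteq> s (j + Suc k)"
    then have div: "r (Suc (i + k) + a) \<noteq> s (Suc (j + k) + b)" for a b
      using rays_diverge[OF tree r s Suc.IH] by simp
    have "range r \<inter> range s \<subseteq> r ` {..i + k} \<union> s ` {..j + k}"
    proof
      fix x assume "x \<in> range r \<inter> range s"
      then obtain a b where ab: "x = r a" "x = s b" by blast
      have "a \<le> i + k \<or> b \<le> j + k"
        using div[of "a - Suc (i + k)" "b - Suc (j + k)"] ab by (cases "a \<le> i + k"; cases "b \<le> j + k") auto
      then show "x \<in> r ` {..i + k} \<union> s ` {..j + k}" using ab by (metis UnI1 UnI2 atMost_iff imageI)
    qed
    then show False using inf by (meson finite_Un finite_atMost finite_imageI finite_subset)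
  qed
qed (use meet in simp)

lemma ray_equivI:
  assumes "r \<in> rays V E" "s \<in> rays V E" "\<And>k. r (i + k) = s (j + k)"
  shows "(r, s) \<in> ray_equiv V E"
proof -
  have "(\<lambda>k. r (i + k)) ` UNIV \<subseteq> range r \<inter> range s" using assms(3) by (metis Int_iff image_subsetI rangeI)
  moreover have "inj r" using assms(1) by (auto simp: rays_def)
  then have "inj (\<lambda>k. r (i + k))" by (metis add_left_imp_eq injD injI)
  then have "infinite (range (\<lambda>k. r (i + k)))" using finite_imageD by blast
  ultimately have "infinite (range r \<inter> range s)" by (metis finite_subset)
  then show ?thesis using assms(1,2) by (auto simp: ray_equiv_def)
qed

lemma ray_equiv_trans:
  assumes "tree V E" "(r, s) \<in> ray_equiv V E" "(s, t) \<in> ray_equiv V E"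
  shows "(r, t) \<in> ray_equiv V E"
proof -
  have "\<exists>i j. r i = s j" "\<exists>i j. s i = t j"
    using assms(2,3) by (auto simp: ray_equiv_def dest!: infinite_imp_nonempty)
  then obtain i j i' j' where "r i = s j" "s i' = t j'" by blast
  then have 1: "\<And>k. r (i + k) = s (j + k)" "\<And>k. s (i' + k) = t (j' + k)"
    using ray_equiv_agree assms by metis+
  have "r (i + i' + k) = t (j' + j + k)" for k
    using 1(1)[of "i' + k"] 1(2)[of "j + k"] by (simp add: ac_simps)
  then show ?thesis using assms by (intro ray_equivI[of _ _ _ _ "i + i'" "j' + j"]) (auto simp: ray_equiv_def)
qed

lemma ray_equiv_sym: "(r, s) \<in> ray_equiv V E \<Longrightarrow> (s, r) \<in> ray_equiv V E"
  by (auto simp: ray_equiv_def Int_commute)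

text \<open>Induction along a path from the start of \<open>r\<close> to \<open>v\<close>. Crossing
  an edge from \<open>u\<close> to \<open>v\<close> either follows the ray of \<open>u\<close>,
  whose tail is then taken, or leaves it, and then \<open>v\<close> can be put in front without
  backtracking.\<close>

lemma ray_in_end_exists:
  assumes tree: "tree V E" and r: "r \<in> rays V E" and v: "v \<in> V"
  shows "\<exists>s. s 0 = v \<and> (r, s) \<in> ray_equiv V E"
proof -
  have sym: "sym E" using tree by (simp add: tree_def simple_graph_def)
  have "r 0 \<in> V" using r by (auto simp: rays_def)
  then have "(r 0, v) \<in> E\<^sup>*" using tree v by (auto simp: tree_def connected_graph_def)
  then show ?thesis
  proof (induction)
    case base
    have "(r, r) \<in> ray_equiv V E" using ray_equivI[OF r r, of 0 0] by simp
    then show ?case by blast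
  next
    case (step u v)
    then obtain s where s: "s 0 = u" "(r, s) \<in> ray_equiv V E" by blast
    then have sr: "s \<in> rays V E" by (simp add: ray_equiv_def)
    show ?case
    proof (cases "v = s 1")
      case True
      have "(\<lambda>i. s (Suc i)) \<in> rays V E" using sr by (auto simp: rays_def inj_def)
      then have "(s, \<lambda>i. s (Suc i)) \<in> ray_equiv V E" using sr by (intro ray_equivI[of _ _ _ _ 1 0]) auto
      then show ?thesis using True s ray_equiv_trans[OF tree] by (intro exI[of _ "\<lambda>i. s (Suc i)"]) auto
    next
      case False
      let ?t = "case_nat v s"
      have "?t \<in> rays V E"
      proof (rule rays_nonbacktracking[OF tree])
        show "(?t i, ?t (Suc i)) \<in> E" for i
          using sr step s symD[OF sym] by (cases i) (auto simp: rays_def)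
        show "?t i \<noteq> ?t (Suc (Suc i))" for i
          using sr False by (cases i) (auto simp: rays_def dest: injD)
      qed
      then have "(s, ?t) \<in> ray_equiv V E" using sr by (intro ray_equivI[of _ _ _ _ 0 1]) auto
      then show ?thesis using s ray_equiv_trans[OF tree] by (intro exI[of _ ?t]) auto
    qed
  qed
qed

text \<open>The parent of a vertex is the second vertex of the unique ray of the end that starts there.\<close>

lemma end_parent_map:
  assumes tree: "tree V E" and \<omega>: "\<omega> \<in> ends V E"
  obtains p where "\<omega> = (\<lambda>v i. (p ^^ i) v) ` V"
    and "\<And>u v. (u, v) \<in> E \<longleftrightarrow> u \<in> V \<and> v \<in> V \<and> (p u = v \<or> p v = u)"
    and "\<And>v. v \<in> V \<Longrightarrow> p v \<in> V"
    and "\<And>v n. v \<in> V \<Longrightarrow> (p ^^ n) v = v \<Longrightarrow> n = 0"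
    and "\<And>u v. u \<in> V \<Longrightarrow> v \<in> V \<Longrightarrow> \<exists>m n. (p ^^ m) u = (p ^^ n) v"
proof -
  obtain r where r: "r \<in> rays V E" and \<omega>r: "\<omega> = ray_equiv V E `` {r}"
    using \<omega> by (auto simp: ends_def quotient_def)
  have sym: "sym E" and EV: "E \<subseteq> V \<times> V" using tree by (auto simp: tree_def simple_graph_def)
  have rays: "s \<in> rays V E" if "s \<in> \<omega>" for s using that \<omega>r by (auto simp: ray_equiv_def)
  have eqv: "(s, t) \<in> ray_equiv V E" if "s \<in> \<omega>" "t \<in> \<omega>" for s t
    using that ray_equiv_trans[OF tree] ray_equiv_sym unfolding \<omega>r by blast
  have inI: "t \<in> \<omega>" if "s \<in> \<omega>" "(s, t) \<in> ray_equiv V E" for s t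
    using that ray_equiv_trans[OF tree] unfolding \<omega>r by blast
  have uniq: "s = t" if "s \<in> \<omega>" "t \<in> \<omega>" "s 0 = t 0" for s t
    using ray_equiv_agree[OF tree eqv[OF that(1,2)] that(3)] by (simp add: fun_eq_iff)
  define ray where "ray v = (SOME s. s \<in> \<omega> \<and> s 0 = v)" for v
  have ray: "ray v \<in> \<omega>" "ray v 0 = v" if "v \<in> V" for v
  proof -
    have "\<exists>s. s \<in> \<omega> \<and> s 0 = v" using ray_in_end_exists[OF tree r that] unfolding \<omega>r by blast
    then show "ray v \<in> \<omega>" "ray v 0 = v" using someI_ex[of "\<lambda>s. s \<in> \<omega> \<and> s 0 = v"] unfolding ray_def by auto
  qed
  define p where "p v = ray v 1" for v
  have rV: "s i \<in> V" and rE: "(s i, s (Suc i)) \<in> E" and rinj: "inj s" if "s \<in> \<omega>" for s i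
    using rays[OF that] by (auto simp: rays_def)
  have shift: "(\<lambda>k. s (i + k)) \<in> \<omega>" if "s \<in> \<omega>" for s i
  proof -
    have "inj (\<lambda>k. s (i + k))" using rinj[OF that] by (metis add_left_imp_eq injD injI)
    then have "(\<lambda>k. s (i + k)) \<in> rays V E" using rays[OF that] by (auto simp: rays_def)
    then show ?thesis
      using rays[OF that] by (intro inI[OF that] ray_equivI[of _ _ _ _ i 0]) auto
  qed
  have step: "s (Suc i) = p (s i)" if "s \<in> \<omega>" for s i
    using uniq[OF ray(1)[OF rV[OF that, of i]] shift[OF that, of i]] ray(2)[OF rV[OF that, of i]]
    by (simp add: p_def)
  have iter: "s i = (p ^^ i) (s 0)" if "s \<in> \<omega>" for s i
    by (induction i) (auto simp: step[OF that])
  have ray_p: "ray v = (\<lambda>i. (p ^^ i) v)" if "v \<in> V" for v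
    using iter[OF ray(1)[OF that]] ray(2)[OF that] by auto
  show ?thesis
  proof
    show "\<omega> = (\<lambda>v i. (p ^^ i) v) ` V"
    proof
      show "\<omega> \<subseteq> (\<lambda>v i. (p ^^ i) v) ` V"
      proof
        fix s assume "s \<in> \<omega>"
        then show "s \<in> (\<lambda>v i. (p ^^ i) v) ` V" using iter rV by (intro image_eqI[of _ _ "s 0"]) auto
      qed
    qed (use ray(1) ray_p in auto)
    show pV: "p v \<in> V" if "v \<in> V" for v using rV[OF ray(1)[OF that]] by (simp add: p_def)
    have pE: "(v, p v) \<in> E" if "v \<in> V" for v using rE[OF ray(1)[OF that], of 0] ray(2)[OF that] by (simp add: p_def)
    show "(u, v) \<in> E \<longleftrightarrow> u \<in> V \<and> v \<in> V \<and> (p u = v \<or> p v = u)" for u v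
    proof
      assume uv: "(u, v) \<in> E"
      then have V: "u \<in> V" "v \<in> V" using EV by auto
      have "p v = u" if "p u \<noteq> v"
      proof -
        \<comment> \<open>If \<open>v\<close> is not the second vertex of the ray from
          \<open>u\<close>, putting \<open>v\<close> in front gives the ray of the end from
          \<open>v\<close>; its second vertex is \<open>u\<close>.\<close>
        let ?t = "case_nat v (ray u)"
        have "?t \<in> rays V E"
        proof (rule rays_nonbacktracking[OF tree])
          show "(?t i, ?t (Suc i)) \<in> E" for i
            using rE[OF ray(1)[OF V(1)]] ray(2)[OF V(1)] symD[OF sym uv] by (cases i) auto
          show "?t i \<noteq> ?t (Suc (Suc i))" for i
            using rinj[OF ray(1)[OF V(1)]] that by (cases i) (auto simp: p_def dest: injD)
        qed
        then have "?t \<in> \<omega>" using rays[OF ray(1)[OF V(1)]]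
          by (intro inI[OF ray(1)[OF V(1)]] ray_equivI[of _ _ _ _ 0 1]) auto
        then show ?thesis using step[of ?t 0] ray(2)[OF V(1)] by simp
      qed
      then show "u \<in> V \<and> v \<in> V \<and> (p u = v \<or> p v = u)" using V by auto
    qed (use pE symD[OF sym] in auto)
    show "n = 0" if "v \<in> V" "(p ^^ n) v = v" for v n
      using rinj[OF ray(1)[OF that(1)]] that ray_p[OF that(1)] by (metis funpow_0 injD)
    show "\<exists>m n. (p ^^ m) u = (p ^^ n) v" if "u \<in> V" "v \<in> V" for u v
    proof -
      have "range (ray u) \<inter> range (ray v) \<noteq> {}"
        using eqv[OF ray(1)[OF that(1)] ray(1)[OF that(2)]] by (auto simp: ray_equiv_def)
      then show ?thesis using ray_p that by auto
    qed
  qed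
qed

lemma regular_tree_parent_map:
  assumes reg: "regular_tree (q + 1) V E" and \<omega>: "\<omega> \<in> ends V E" and q: "q \<ge> 2"
  obtains p where "parent_tree q V p"
    and "Isom_end V E \<omega> = {g \<in> Bij V. \<forall>v\<in>V. g (p v) = p (g v)}"
proof -
  have tree: "tree V E" using reg by (simp add: regular_tree_def)
  obtain p where p: "\<omega> = (\<lambda>v i. (p ^^ i) v) ` V"
    and E: "\<And>u v. (u, v) \<in> E \<longleftrightarrow> u \<in> V \<and> v \<in> V \<and> (p u = v \<or> p v = u)"
    and pV: "\<And>v. v \<in> V \<Longrightarrow> p v \<in> V"
    and acyc: "\<And>v n. v \<in> V \<Longrightarrow> (p ^^ n) v = v \<Longrightarrow> n = 0"
    and mrg: "\<And>u v. u \<in> V \<Longrightarrow> v \<in> V \<Longrightarrow> \<exists>m n. (p ^^ m) u = (p ^^ n) v"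
    using end_parent_map[OF tree \<omega>] by blast
  have "parent_tree q V p"
  proof
    show "V \<noteq> {}" using tree by (simp add: tree_def connected_graph_def)
    show "card {u \<in> V. p u = v} = q" if "v \<in> V" for v
    proof -
      have nb: "{w. (v, w) \<in> E} = insert (p v) {u \<in> V. p u = v}" using E pV that by auto
      \<comment> \<open>A parent that is also a child would satisfy \<open>p (p v) = v\<close>. So
        the q + 1 neighbours are the parent and exactly q children.\<close>
      have "p v \<notin> {u \<in> V. p u = v}" using acyc[OF that, of 2] by (auto simp: numeral_2_eq_2)
      moreover have "finite {w. (v, w) \<in> E}" "card {w. (v, w) \<in> E} = q + 1"
        using reg that by (auto simp: regular_tree_def)
      ultimately show ?thesis unfolding nb by simp
    qed
  qed (use pV acyc mrg q in auto)
  moreover have "Isom_end V E \<omega> = {g \<in> Bij V. \<forall>v\<in>V. g (p v) = p (g v)}"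
  proof (intro equalityI subsetI)
    fix g assume g: "g \<in> Isom_end V E \<omega>"
    have "g (p v) = p (g v)" if "v \<in> V" for v
    proof -
      \<comment> \<open>The image of the ray from \<open>v\<close> is again a ray of the end, hence
        the \<open>p\<close>-orbit of some \<open>w\<close>. Index 0 gives \<open>w = g v\<close>,
        and index 1 gives the commutation.\<close>
      have "g \<circ> (\<lambda>i. (p ^^ i) v) \<in> \<omega>" using g that p unfolding Isom_end_def by blast
      then obtain w where w: "g \<circ> (\<lambda>i. (p ^^ i) v) = (\<lambda>i. (p ^^ i) w)" using p by auto
      from fun_cong[OF w, of 0] fun_cong[OF w, of 1] show ?thesis by simp
    qed
    then show "g \<in> {g \<in> Bij V. \<forall>v\<in>V. g (p v) = p (g v)}"
      using g by (simp add: Isom_end_def Isom_def)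
  next
    fix g assume "g \<in> {g \<in> Bij V. \<forall>v\<in>V. g (p v) = p (g v)}"
    then have g: "g \<in> Bij V" and comm: "\<And>v. v \<in> V \<Longrightarrow> g (p v) = p (g v)" by auto
    have inj: "inj_on g V" and im: "g ` V = V" using g by (auto simp: Bij_def bij_betw_def)
    have "(g u, g v) \<in> E \<longleftrightarrow> (u, v) \<in> E" if "u \<in> V" "v \<in> V" for u v
    proof -
      have "g u \<in> V" "g v \<in> V" using that im by auto
      then show ?thesis unfolding E using that comm[OF that(1)] comm[OF that(2)]
        inj_on_eq_iff[OF inj pV[OF that(1)] that(2)] inj_on_eq_iff[OF inj pV[OF that(2)] that(1)] by simp
    qed
    moreover have "g \<circ> (\<lambda>i. (p ^^ i) v) = (\<lambda>i. (p ^^ i) (g v))" if "v \<in> V" for v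
    proof
      have "(p ^^ i) v \<in> V \<and> g ((p ^^ i) v) = (p ^^ i) (g v)" for i
        by (induction i) (auto simp: pV comm that)
      then show "(g \<circ> (\<lambda>i. (p ^^ i) v)) i = (p ^^ i) (g v)" for i by simp
    qed
    then have "(\<lambda>r. g \<circ> r) ` \<omega> = (\<lambda>v i. (p ^^ i) v) ` (g ` V)" unfolding p image_image by (rule image_cong[OF refl])
    then have "(\<lambda>r. g \<circ> r) ` \<omega> = \<omega>" unfolding im p .
    ultimately show "g \<in> Isom_end V E \<omega>" using g by (simp add: Isom_end_def Isom_def)
  qed
  ultimately show ?thesis using that by blast
qed

section \<open>Uniqueness of the directed tree\<close>

text \<open>A vertex is coded by its level together with the labels met on its way to the end. Labels
  number the children of a vertex, and they vanish along one fixed ray of the end.\<close>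

definition code_words :: "nat \<Rightarrow> (int \<times> (nat \<Rightarrow> nat)) set" where
  "code_words q = {(z, s). (\<forall>i. s i < q) \<and> (\<exists>N. \<forall>i\<ge>N. s i = 0)}"

context parent_tree
begin

lemma labelling_exists:
  assumes x0: "x0 \<in> X"
  shows "\<exists>l. (\<forall>v\<in>X. bij_betw l {u \<in> X. p u = v} {..<q}) \<and> (\<forall>k. l ((p ^^ k) x0) = 0)"
proof -
  have "\<forall>v\<in>X. \<exists>h. bij_betw h {u \<in> X. p u = v} {..<q} \<and> (\<forall>k. p ((p ^^ k) x0) = v \<longrightarrow> h ((p ^^ k) x0) = 0)"
  proof
    fix v assume v: "v \<in> X"
    let ?C = "{u \<in> X. p u = v}"
    obtain h0 where h0: "bij_betw h0 ?C {..<q}"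
      using ex_bij_betw_finite_nat[OF finite_children[OF v]] card_children[OF v] by (auto simp: atLeast0LessThan)
    show "\<exists>h. bij_betw h ?C {..<q} \<and> (\<forall>k. p ((p ^^ k) x0) = v \<longrightarrow> h ((p ^^ k) x0) = 0)"
    proof (cases "\<exists>k. p ((p ^^ k) x0) = v")
      case True
      then obtain k where k: "p ((p ^^ k) x0) = v" by blast
      define c where "c = (p ^^ k) x0"
      have uniq: "(p ^^ k') x0 = c" if "p ((p ^^ k') x0) = v" for k'
        using funpow_inj[OF x0, of "Suc k" "Suc k'"] that k by (auto simp: c_def)
      have c: "c \<in> ?C" using k funpow_closed[OF x0] by (auto simp: c_def)
      \<comment> \<open>This is \<open>h0\<close> followed by the transposition of \<open>0\<close>
        and \<open>h0 c\<close>. By \<open>uniq\<close> the vertex \<open>c\<close> is the only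
        child of \<open>v\<close> on the ray from \<open>x0\<close>, so no other label there has to
        vanish.\<close>
      define h where "h x = (if h0 x = 0 then h0 c else if h0 x = h0 c then 0 else h0 x)" for x
      have inj: "inj_on h ?C" using h0 by (auto simp: inj_on_def h_def bij_betw_def split: if_splits)
      moreover have "h ` ?C \<subseteq> {..<q}" using h0 c q_ge2 by (auto simp: h_def bij_betw_def split: if_splits)
      then have "h ` ?C = {..<q}"
        by (intro card_subset_eq) (auto simp: card_image[OF inj] card_children[OF v])
      ultimately have "bij_betw h ?C {..<q}" using inj by (simp add: bij_betw_def)
      moreover have "h c = 0" by (simp add: h_def)
      moreover have "h ((p ^^ j) x0) = 0" if "p ((p ^^ j) x0) = v" for j
        using uniq[OF that] \<open>h c = 0\<close> by simp
      ultimately show ?thesis by blast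
    qed (use h0 in blast)
  qed
  from bchoice[OF this] obtain h where hh: "\<forall>v\<in>X. bij_betw (h v) {u \<in> X. p u = v} {..<q} \<and>
    (\<forall>k. p ((p ^^ k) x0) = v \<longrightarrow> h v ((p ^^ k) x0) = 0)" ..
  have h: "bij_betw (h v) {u \<in> X. p u = v} {..<q}" "p ((p ^^ k) x0) = v \<Longrightarrow> h v ((p ^^ k) x0) = 0"
    if "v \<in> X" for v k
    using bspec[OF hh that] by simp_all
  show ?thesis
  proof (intro exI[of _ "\<lambda>u. h (p u) u"] conjI ballI allI)
    show "bij_betw (\<lambda>u. h (p u) u) {u \<in> X. p u = v} {..<q}" if "v \<in> X" for v
      by (rule bij_betw_cong[THEN iffD1, OF _ h(1)[OF that]]) auto
    show "h (p ((p ^^ k) x0)) ((p ^^ k) x0) = 0" for k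
      using h(2) parent_closed funpow_closed[OF x0] by blast
  qed
qed

text \<open>In the code the parent map raises the level and drops the first label, whatever the
  tree. A code determines its vertex because vertices of equal level merge, and equal labels then
  allow going back down from the meeting point along the same children.\<close>

lemma coding_exists:
  "\<exists>c. bij_betw c X (code_words q) \<and>
     (\<forall>v\<in>X. c (p v) = (fst (c v) + 1, \<lambda>i. snd (c v) (Suc i)))"
proof -
  obtain x0 where x0: "x0 \<in> X" using nonempty by auto
  obtain l where l: "\<And>v. v \<in> X \<Longrightarrow> bij_betw l {u \<in> X. p u = v} {..<q}"
    and l0: "\<And>k. l ((p ^^ k) x0) = 0" using labelling_exists[OF x0] by blast
  define c where "c v = (level v - level x0, \<lambda>i. l ((p ^^ i) v))" for v
  have lq: "l v < q" if "v \<in> X" for v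
    using l[OF parent_closed[OF that]] that by (auto simp: bij_betw_def)
  have "inj_on c X"
  proof (rule inj_onI)
    fix u v assume u: "u \<in> X" and v: "v \<in> X" and "c u = c v"
    then have lev: "level u = level v" and lab: "l ((p ^^ i) u) = l ((p ^^ i) v)" for i
      by (auto simp: c_def dest: fun_cong)
    have "u = v" if "u \<in> X" "v \<in> X" "\<And>i. l ((p ^^ i) u) = l ((p ^^ i) v)" "(p ^^ n) u = (p ^^ n) v" for n u v
      using that
    proof (induction n arbitrary: u v)
      case (Suc n)
      have "l ((p ^^ i) (p u)) = l ((p ^^ i) (p v))" for i
        using Suc.prems(3)[of "Suc i"] by (simp add: funpow_swap1)
      moreover have "(p ^^ n) (p u) = (p ^^ n) (p v)" using Suc.prems(4) by (simp add: funpow_swap1)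
      ultimately have "p u = p v" using Suc.IH[of "p u" "p v"] Suc.prems parent_closed by blast
      moreover have "l u = l v" using Suc.prems(3)[of 0] by simp
      ultimately show ?case
        using l[OF parent_closed[OF Suc.prems(1)]] Suc.prems by (auto simp: bij_betw_def dest: inj_onD)
    qed simp
    moreover obtain n where "(p ^^ n) u = (p ^^ n) v" using merge_same_level[OF u v lev] by blast
    ultimately show "u = v" using u v lab by blast
  qed
  moreover have "c v \<in> code_words q" if v: "v \<in> X" for v
  proof -
    obtain m n where mn: "(p ^^ m) v = (p ^^ n) x0" using merge[OF v x0] by blast
    have "l ((p ^^ i) v) = 0" if "i \<ge> m" for i
    proof -
      have "(p ^^ i) v = (p ^^ (i - m)) ((p ^^ m) v)"
        using that by (metis comp_apply funpow_add le_add_diff_inverse2)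
      also have "\<dots> = (p ^^ (i - m + n)) x0" by (simp add: mn funpow_add)
      finally show ?thesis using l0 by simp
    qed
    then show ?thesis using lq funpow_closed[OF v] by (auto simp: c_def code_words_def)
  qed
  moreover have "w \<in> c ` X" if "w \<in> code_words q" for w
  proof -
    obtain z s N0 where w: "w = (z, s)" "\<And>i. s i < q" "\<And>i. i \<ge> N0 \<Longrightarrow> s i = 0"
      using \<open>w \<in> code_words q\<close> by (auto simp: code_words_def)
    \<comment> \<open>From time \<open>N\<close> on all labels vanish, and \<open>N\<close> is at
      least \<open>- z\<close>, so that \<open>n = z + N\<close> is a natural number. The vertex
      sought lies \<open>N\<close> steps below the \<open>n\<close>-th vertex of the ray from
      \<open>x0\<close>, which puts it at level \<open>z\<close> relative to
      \<open>x0\<close>.\<close>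
    define N where "N = max N0 (nat (- z))"
    define n where "n = nat (z + int N)"
    have n: "int n = z + int N" by (simp add: n_def N_def)
    have "\<exists>x\<in>X. (p ^^ N) x = y \<and> (\<forall>i<N. l ((p ^^ i) x) = s i)" if "y \<in> X" for N y
      using that
    proof (induction N arbitrary: y)
      case (Suc N)
      obtain d where d: "d \<in> X" "p d = y" "l d = s N"
      proof -
        have "s N \<in> l ` {u \<in> X. p u = y}" using l[OF Suc.prems] w(2)[of N] by (simp add: bij_betw_def)
        then show ?thesis using that by auto
      qed
      obtain x where "x \<in> X" "(p ^^ N) x = d" "\<forall>i<N. l ((p ^^ i) x) = s i" using Suc.IH[OF d(1)] by blast
      then show ?case using d by (intro bexI[of _ x]) (auto simp: less_Suc_eq)
    qed auto
    then obtain x where x: "x \<in> X" "(p ^^ N) x = (p ^^ n) x0" "\<And>i. i < N \<Longrightarrow> l ((p ^^ i) x) = s i"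
      using funpow_closed[OF x0] by blast
    have "l ((p ^^ i) x) = s i" for i
    proof (cases "i < N")
      case False
      have "(p ^^ i) x = (p ^^ (i - N)) ((p ^^ N) x)"
        using False by (metis comp_apply funpow_add le_add_diff_inverse2 not_less)
      also have "\<dots> = (p ^^ (i - N + n)) x0" by (simp add: x(2) funpow_add)
      finally show ?thesis using l0 w(3)[of i] False by (simp add: N_def)
    qed (use x in blast)
    moreover have "level x - level x0 = z"
      using level_funpow[OF x(1), of N] level_funpow[OF x0, of n] x(2) n by simp
    ultimately have "c x = w" by (simp add: c_def w(1))
    then show ?thesis using x(1) by blast
  qed
  ultimately have "bij_betw c X (code_words q)" unfolding bij_betw_def by blast
  moreover have "c (p v) = (fst (c v) + 1, \<lambda>i. snd (c v) (Suc i))" if "v \<in> X" for v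
    using level_parent[OF that] by (simp add: c_def funpow_swap1)
  ultimately show ?thesis by blast
qed

end

text \<open>Both parent maps become the same shift on \<open>code_words q\<close>, so one coding
  followed by the inverse of the other intertwines them.\<close>

lemma parent_tree_unique:
  assumes "parent_tree q X p" "parent_tree q Y r"
  shows "\<exists>F. bij_betw F X Y \<and> (\<forall>v\<in>X. F (p v) = r (F v))"
proof -
  interpret A: parent_tree q X p by fact
  interpret B: parent_tree q Y r by fact
  obtain c where c: "bij_betw c X (code_words q)" "\<And>v. v \<in> X \<Longrightarrow> c (p v) = (fst (c v) + 1, \<lambda>i. snd (c v) (Suc i))"
    using A.coding_exists by blast
  obtain d where d: "bij_betw d Y (code_words q)" "\<And>v. v \<in> Y \<Longrightarrow> d (r v) = (fst (d v) + 1, \<lambda>i. snd (d v) (Suc i))"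
    using B.coding_exists by blast
  let ?F = "inv_into Y d \<circ> c"
  have F: "bij_betw ?F X Y" using bij_betw_trans[OF c(1) bij_betw_inv_into[OF d(1)]] .
  have dF: "d (?F v) = c v" if "v \<in> X" for v
    using bij_betw_inv_into_right[OF d(1), of "c v"] bij_betwE[OF c(1)] that by simp
  have "?F (p v) = r (?F v)" if v: "v \<in> X" for v
  proof -
    have Fv: "?F v \<in> Y" "?F (p v) \<in> Y" using F v A.parent_closed by (auto simp: bij_betw_def)
    have "d (r (?F v)) = d (?F (p v))" by (simp only: d(2)[OF Fv(1)] c(2)[OF v] dF[OF v] dF[OF A.parent_closed[OF v]])
    then show ?thesis using d(1) Fv B.parent_closed by (metis bij_betw_def inj_onD)
  qed
  then show ?thesis using F by blast
qed

section \<open>Groups acting on directed trees\<close>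

lemma group_actionI:
  assumes "group G" "\<And>g. g \<in> carrier G \<Longrightarrow> \<phi> g \<in> Bij X"
    and "\<And>g h. g \<in> carrier G \<Longrightarrow> h \<in> carrier G \<Longrightarrow> \<phi> (g \<otimes>\<^bsub>G\<^esub> h) = compose X (\<phi> g) (\<phi> h)"
  shows "group_action G X \<phi>"
  unfolding group_action_def group_hom_def group_hom_axioms_def
  using assms group_BijGroup by (auto simp: hom_def BijGroup_def)

text \<open>The topology enters only through the transporters of vertices. Open transporters give
  continuity of \<phi> into the automorphisms, compact ones make it a closed map.\<close>

locale tree_action = parent_tree q X p + group_action G X \<phi>
  for q and X :: "'v set" and p and G :: "('a, 'm) monoid_scheme" (structure) and \<phi> +
  fixes T :: "'a topology"
  assumes equivariant: "g \<in> carrier G \<Longrightarrow> v \<in> X \<Longrightarrow> \<phi> g (p v) = p (\<phi> g v)"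
    and transitive: "u \<in> X \<Longrightarrow> v \<in> X \<Longrightarrow> \<exists>g\<in>carrier G. \<phi> g u = v"
    and faithful: "inj_on \<phi> (carrier G)"
    and compact_transporter: "u \<in> X \<Longrightarrow> v \<in> X \<Longrightarrow> compactin T {g \<in> carrier G. \<phi> g u = v}"
    and open_transporter: "u \<in> X \<Longrightarrow> v \<in> X \<Longrightarrow> openin T {g \<in> carrier G. \<phi> g u = v}"

text \<open>This carries the action on cosets over to the given tree. Conjugating by
  \<open>F\<close> changes no transporter as a subset of \<open>G\<close>, so their topological
  properties persist.\<close>

lemma tree_action_transport:
  assumes "tree_action q X p G \<phi> T" "parent_tree q Y r"
  shows "\<exists>\<psi>. tree_action q Y r G \<psi> T"
proof -
  interpret tree_action q X p G \<phi> T by fact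
  interpret B: parent_tree q Y r by fact
  obtain F where F: "bij_betw F X Y" and Fp: "\<And>v. v \<in> X \<Longrightarrow> F (p v) = r (F v)"
    using parent_tree_unique[OF parent_tree_axioms assms(2)] by blast
  define I where "I = inv_into X F"
  have I: "I y \<in> X" "F (I y) = y" if "y \<in> Y" for y
    using F that by (auto simp: I_def bij_betw_def inv_into_into f_inv_into_f)
  have IF: "I (F v) = v" if "v \<in> X" for v using F that by (simp add: I_def bij_betw_def)
  have FX: "F v \<in> Y" if "v \<in> X" for v using F that by (auto simp: bij_betw_def)
  define \<psi> where "\<psi> g = (\<lambda>y\<in>Y. F (\<phi> g (I y)))" for g
  have cl: "\<phi> g v \<in> X" if "g \<in> carrier G" "v \<in> X" for g v using element_image that by blast
  have eq: "\<psi> g u = v \<longleftrightarrow> \<phi> g (I u) = I v" if "g \<in> carrier G" "u \<in> Y" "v \<in> Y" for g u v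
    using that I IF cl by (metis \<psi>_def restrict_apply')
  have "tree_action q Y r G \<psi> T"
  proof (intro tree_action.intro tree_action_axioms.intro)
    show "group_action G Y \<psi>"
    proof (rule group_actionI)
      show "group G" using group_hom group_hom.axioms(1) by blast
      fix g assume g: "g \<in> carrier G"
      have "bij_betw (F \<circ> \<phi> g \<circ> I) Y Y"
        using bij_betw_trans[OF bij_betw_trans[OF bij_betw_inv_into[OF F]] F] bij_prop0[OF g]
        by (simp add: I_def Bij_def comp_assoc)
      then show "\<psi> g \<in> Bij Y" by (simp add: Bij_def \<psi>_def bij_betw_restrict_eq comp_def)
      fix h assume h: "h \<in> carrier G"
      show "\<psi> (g \<otimes>\<^bsub>G\<^esub> h) = compose Y (\<psi> g) (\<psi> h)"
        using composition_rule[OF _ g h] I IF FX cl[OF h] by (auto simp: \<psi>_def compose_def fun_eq_iff)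
    qed
    show "\<psi> g (r v) = r (\<psi> g v)" if "g \<in> carrier G" "v \<in> Y" for g v
    proof -
      have "I (r v) = p (I v)" using Fp[OF I(1)[OF that(2)]] I(2)[OF that(2)] IF[OF parent_closed[OF I(1)[OF that(2)]]] by simp
      then show ?thesis using that B.parent_closed I equivariant Fp cl by (simp add: \<psi>_def)
    qed
    show "\<exists>g\<in>carrier G. \<psi> g u = v" if "u \<in> Y" "v \<in> Y" for u v
      using transitive[OF I(1)[OF that(1)] I(1)[OF that(2)]] eq that by blast
    show "inj_on \<psi> (carrier G)"
    proof (rule inj_onI)
      fix g h assume gh: "g \<in> carrier G" "h \<in> carrier G" "\<psi> g = \<psi> h"
      have "\<phi> g v = \<phi> h v" if "v \<in> X" for v
      proof -
        have "F (\<phi> g v) = F (\<phi> h v)"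
          using fun_cong[OF gh(3), of "F v"] FX[OF that] IF[OF that] by (simp add: \<psi>_def)
        from arg_cong[OF this, of I] show ?thesis
          unfolding IF[OF cl[OF gh(1) that]] IF[OF cl[OF gh(2) that]] .
      qed
      moreover have "\<phi> g \<in> extensional X" "\<phi> h \<in> extensional X" using bij_prop0 gh by (auto simp: Bij_def)
      ultimately have "\<phi> g = \<phi> h" by (meson extensionalityI)
      then show "g = h" using faithful gh by (auto dest: inj_onD)
    qed
    fix u v assume uv: "u \<in> Y" "v \<in> Y"
    have "{g \<in> carrier G. \<psi> g u = v} = {g \<in> carrier G. \<phi> g (I u) = I v}" using eq uv by blast
    then show "compactin T {g \<in> carrier G. \<psi> g u = v}" "openin T {g \<in> carrier G. \<psi> g u = v}"
      using compact_transporter open_transporter I(1) uv by auto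
  qed (fact assms(2))
  then show ?thesis by blast
qed

lemma (in group) mult_inv_cancel:
  assumes "g \<in> carrier G" "y \<in> carrier G"
  shows "g \<otimes> (inv g \<otimes> y) = y" and "inv g \<otimes> (g \<otimes> y) = y"
  using assms by (simp_all flip: m_assoc)

context tree_action
begin

sublocale group G
  using group_hom by (rule group_hom.axioms(1))

lemma act_closed: "g \<in> carrier G \<Longrightarrow> v \<in> X \<Longrightarrow> \<phi> g v \<in> X"
  using element_image by blast

lemma act_one: "v \<in> X \<Longrightarrow> \<phi> \<one> v = v"
  by (metis id_eq_one restrict_apply')

lemma act_inv_eq_iff: "g \<in> carrier G \<Longrightarrow> u \<in> X \<Longrightarrow> v \<in> X \<Longrightarrow> \<phi> (inv g) u = v \<longleftrightarrow> \<phi> g v = u"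
  using orbit_sym_aux inv_closed inv_inv by metis

lemma act_funpow: "g \<in> carrier G \<Longrightarrow> v \<in> X \<Longrightarrow> \<phi> g ((p ^^ n) v) = (p ^^ n) (\<phi> g v)"
  by (induction n) (auto simp: equivariant funpow_closed)

lemma act_trivial_imp_one:
  assumes g: "g \<in> carrier G" and triv: "\<And>v. v \<in> X \<Longrightarrow> \<phi> g v = v"
  shows "g = \<one>"
proof -
  have "\<phi> g \<in> extensional X" "\<phi> \<one> \<in> extensional X" using bij_prop0 g by (auto simp: Bij_def)
  then have "\<phi> g = \<phi> \<one>" by (rule extensionalityI) (simp add: triv act_one)
  then show ?thesis using faithful g by (auto dest: inj_onD)
qed

text \<open>Two vertices have a common ancestor, and \<open>g\<close> commutes with taking
  ancestors, so the displacement is the one of that ancestor for both.\<close>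

lemma level_shift_constant:
  assumes g: "g \<in> carrier G" and u: "u \<in> X" and v: "v \<in> X"
  shows "level (\<phi> g u) - level u = level (\<phi> g v) - level v"
proof -
  obtain m n where mn: "(p ^^ m) u = (p ^^ n) v" using merge u v by blast
  then have "(p ^^ m) (\<phi> g u) = (p ^^ n) (\<phi> g v)" using act_funpow[OF g] u v by metis
  then have "level (\<phi> g u) + m = level (\<phi> g v) + n"
    using level_funpow act_closed g u v by metis
  moreover have "level u + m = level v + n" using mn level_funpow u v by metis
  ultimately show ?thesis by linarith
qed

section \<open>Compact normal subgroups of a group acting on a directed tree\<close>

lemma compact_orbit_finite:
  assumes N: "compactin T N" "N \<subseteq> carrier G" and v: "v \<in> X"
  shows "finite ((\<lambda>g. \<phi> g v) ` N)"
proof -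
  let ?U = "\<lambda>w. {g \<in> carrier G. \<phi> g v = w}"
  have "N \<subseteq> \<Union>(?U ` X)" using N(2) act_closed v by auto
  then obtain \<F> where \<F>: "finite \<F>" "\<F> \<subseteq> ?U ` X" "N \<subseteq> \<Union>\<F>"
    using compactinD[OF N(1), of "?U ` X"] open_transporter[OF v] by auto
  obtain F where "finite F" "\<F> = ?U ` F" using finite_subset_image[OF \<F>(1,2)] by blast
  then have "finite F" "N \<subseteq> \<Union>(?U ` F)" using \<F>(3) by auto
  then have "(\<lambda>g. \<phi> g v) ` N \<subseteq> F" by auto
  then show ?thesis using \<open>finite F\<close> finite_subset by blast
qed

lemma no_compact_normal: "no_compact_normal_subgroup G T"
  unfolding no_compact_normal_subgroup_def
proof (intro allI impI, elim conjE)
  fix N assume N: "N \<lhd> G" and comp: "compactin T N"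
  interpret N: normal N G by fact
  obtain v where v: "v \<in> X" using nonempty by blast
  have fin: "finite ((\<lambda>g. \<phi> g v) ` N)" using compact_orbit_finite[OF comp N.subset v] .
  have lev: "level (\<phi> n v) = level v" if n: "n \<in> N" for n
  proof (rule ccontr)
    assume ne: "level (\<phi> n v) \<noteq> level v"
    \<comment> \<open>The levels of the images of \<open>v\<close> under the powers of
      \<open>n\<close> would form an arithmetic progression with difference
      \<open>d \<noteq> 0\<close>, which is impossible in a finite orbit.\<close>
    define d where "d = level (\<phi> n v) - level v"
    have nG: "n \<in> carrier G" using n N.subset by blast
    have nk: "n [^] k \<in> N" for k :: nat
      by (induction k) (auto simp: n)
    have "level (\<phi> (n [^] k) v) = level v + int k * d" for k :: nat
    proof (induction k)
      case (Suc k)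
      have "\<phi> (n [^] Suc k) v = \<phi> (n [^] k) (\<phi> n v)" using composition_rule[OF v nat_pow_closed[OF nG] nG] by simp
      moreover have "level (\<phi> (n [^] k) (\<phi> n v)) - level (\<phi> n v) = level (\<phi> (n [^] k) v) - level v"
        using level_shift_constant[OF nat_pow_closed[OF nG] act_closed[OF nG v] v] .
      ultimately show ?case using Suc by (simp add: d_def algebra_simps)
    qed (simp add: act_one v)
    moreover have "inj (\<lambda>k. level v + int k * d)" using ne by (auto simp: inj_def d_def)
    ultimately have "infinite (range (\<lambda>k::nat. level (\<phi> (n [^] k) v)))" using finite_imageD by fastforce
    moreover have "range (\<lambda>k::nat. level (\<phi> (n [^] k) v)) \<subseteq> level ` (\<lambda>g. \<phi> g v) ` N" using nk by auto
    ultimately show False using fin by (meson finite_imageI finite_subset)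
  qed
  have "\<exists>k. (p ^^ k) (\<phi> n v) = (p ^^ k) v" if "n \<in> N" for n
    using merge_same_level[OF act_closed v lev] that N.subset v by blast
  then have "\<forall>w\<in>(\<lambda>g. \<phi> g v) ` N. \<exists>k. (p ^^ k) w = (p ^^ k) v" by blast
  from bchoice[OF this] obtain K where K: "\<And>w. w \<in> (\<lambda>g. \<phi> g v) ` N \<Longrightarrow> (p ^^ (K w)) w = (p ^^ (K w)) v"
    by blast
  \<comment> \<open>A point \<open>w\<close> of the orbit has merged with the ray from
    \<open>v\<close> after \<open>K w\<close> steps. After the maximum of these times all points
    have, so \<open>(p ^^ M) v\<close> is fixed by all of \<open>N\<close>; normality transfers this
    to every vertex.\<close>
  define M where "M = Max (K ` (\<lambda>g. \<phi> g v) ` N)"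
  have fixM: "\<phi> n ((p ^^ M) v) = (p ^^ M) v" if n: "n \<in> N" for n
  proof -
    have "K (\<phi> n v) \<le> M" unfolding M_def by (rule Max_ge) (use fin n in auto)
    then obtain j where "M = j + K (\<phi> n v)" by (metis le_add_diff_inverse2)
    then have "(p ^^ M) (\<phi> n v) = (p ^^ M) v" using K[of "\<phi> n v"] n by (simp add: funpow_add)
    then show ?thesis using act_funpow n N.subset v by auto
  qed
  show "N = {\<one>}"
  proof
    show "N \<subseteq> {\<one>}"
    proof
      fix n assume n: "n \<in> N"
      then have nG: "n \<in> carrier G" using N.subset by blast
      have "\<phi> n y = y" if y: "y \<in> X" for y
      proof -
        define u where "u = (p ^^ M) v"
        have u: "u \<in> X" using funpow_closed v by (simp add: u_def)
        obtain g where g: "g \<in> carrier G" "\<phi> g u = y" using transitive[OF u y] by blast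
        have "inv g \<otimes> n \<otimes> g \<in> N" using N.inv_op_closed1 g n by blast
        then have "\<phi> (inv g \<otimes> n \<otimes> g) u = u" using fixM by (simp add: u_def)
        then have "\<phi> (inv g) (\<phi> n y) = u"
          using g nG u y by (simp add: composition_rule act_closed)
        then show ?thesis using act_inv_eq_iff[OF g(1) act_closed[OF nG y] u] g(2) by simp
      qed
      then show "n \<in> {\<one>}" using act_trivial_imp_one[OF nG] by simp
    qed
  qed simp
qed

section \<open>The Busemann character of the action and conditions (2) and (3)\<close>

definition shift :: "'a \<Rightarrow> int" where
  "shift g = level (\<phi> g (SOME v. v \<in> X)) - level (SOME v. v \<in> X)"

lemma shift_eq: "g \<in> carrier G \<Longrightarrow> v \<in> X \<Longrightarrow> shift g = level (\<phi> g v) - level v"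
  unfolding shift_def using level_shift_constant some_in_eq nonempty by metis

lemma shift_hom: "group_hom G integer_group shift"
proof -
  obtain v where v: "v \<in> X" using nonempty by blast
  have "shift (g \<otimes> h) = shift g + shift h" if "g \<in> carrier G" "h \<in> carrier G" for g h
    using shift_eq[OF _ v] shift_eq[OF that(1) act_closed[OF that(2) v]] that
    by (simp add: composition_rule v)
  then show ?thesis
    by (intro group_hom.intro group_hom_axioms.intro) (auto simp: hom_def intro: is_group)
qed

lemma level_surj: assumes "v \<in> X" shows "\<exists>w\<in>X. level w = level v + z"
proof (cases "z \<ge> 0")
  case True
  then show ?thesis using level_funpow[OF assms, of "nat z"] funpow_closed[OF assms, of "nat z"]
    by (intro bexI[of _ "(p ^^ nat z) v"]) auto
next
  case False
  have "card {u \<in> X. (p ^^ nat (-z)) u = v} > 0" using descendants_finite_card[OF assms] q_ge2 by simp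
  then have "{u \<in> X. (p ^^ nat (-z)) u = v} \<noteq> {}" by fastforce
  then obtain u where "u \<in> X" "(p ^^ nat (-z)) u = v" by auto
  then show ?thesis using level_funpow[of u "nat (-z)"] False by (intro bexI[of _ u]) auto
qed

lemma open_normal_kernel: "open_normal_with_quotient_Z G T (kernel G integer_group shift)"
proof -
  interpret s: group_hom G integer_group shift by (fact shift_hom)
  obtain v where v: "v \<in> X" using nonempty by blast
  \<comment> \<open>An element has shift 0 iff it takes \<open>v\<close> to a vertex of the same
    level, so the kernel is a union of open transporters.\<close>
  have "kernel G integer_group shift = \<Union>((\<lambda>w. {g \<in> carrier G. \<phi> g v = w}) ` {w \<in> X. level w = level v})"
    using shift_eq[OF _ v] act_closed[OF _ v] by (auto simp: kernel_def)
  then have "openin T (kernel G integer_group shift)" using open_transporter[OF v] by auto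
  moreover have "shift ` carrier G = UNIV"
  proof -
    have "z \<in> shift ` carrier G" for z
    proof -
      obtain w where w: "w \<in> X" "level w = level v + z" using level_surj[OF v] by blast
      obtain g where "g \<in> carrier G" "\<phi> g v = w" using transitive[OF v w(1)] by blast
      then show ?thesis using shift_eq[OF _ v] w(2) by (intro image_eqI[of _ _ g]) auto
    qed
    then show ?thesis by blast
  qed
  then have "G Mod kernel G integer_group shift \<cong> integer_group"
    using s.FactGroup_iso_set is_isoI by fastforce
  ultimately show ?thesis unfolding open_normal_with_quotient_Z_def using s.normal_kernel by blast
qed

lemma conj_stabilizer:
  assumes g: "g \<in> carrier G" and v: "v \<in> X"
  shows "conj_set G g {h \<in> carrier G. \<phi> h v = v} = {h \<in> carrier G. \<phi> h (\<phi> g v) = \<phi> g v}"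
proof (intro equalityI subsetI)
  fix k assume "k \<in> conj_set G g {h \<in> carrier G. \<phi> h v = v}"
  then obtain h where h: "h \<in> carrier G" "\<phi> h v = v" "k = g \<otimes> h \<otimes> inv g" by (auto simp: conj_set_def)
  have "\<phi> (inv g) (\<phi> g v) = v" using act_inv_eq_iff g v act_closed by blast
  then show "k \<in> {h \<in> carrier G. \<phi> h (\<phi> g v) = \<phi> g v}"
    using h g v by (simp add: composition_rule act_closed)
next
  fix k assume "k \<in> {h \<in> carrier G. \<phi> h (\<phi> g v) = \<phi> g v}"
  then have k: "k \<in> carrier G" "\<phi> k (\<phi> g v) = \<phi> g v" by auto
  have "\<phi> (inv g) (\<phi> g v) = v" using act_inv_eq_iff g v act_closed by blast
  then have "\<phi> (inv g \<otimes> k \<otimes> g) v = v" using k g v by (simp add: composition_rule act_closed)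
  moreover have "k = g \<otimes> (inv g \<otimes> k \<otimes> g) \<otimes> inv g" using k g by (simp add: m_assoc mult_inv_cancel)
  ultimately show "k \<in> conj_set G g {h \<in> carrier G. \<phi> h v = v}" using k g unfolding conj_set_def by blast
qed

lemma stabilizer_compact_open: "v \<in> X \<Longrightarrow> compact_open_subgroup G T {g \<in> carrier G. \<phi> g v = v}"
  using stabilizer_subgroup[of v] compact_transporter[of v v] open_transporter[of v v]
  by (simp add: compact_open_subgroup_def stabilizer_def)

lemma ascending_union: "ascending_union_of_conjugates G T (kernel G integer_group shift)"
proof -
  obtain v where v: "v \<in> X" using nonempty by blast
  let ?S = "\<lambda>v. {g \<in> carrier G. \<phi> g v = v}"
  have "card {u \<in> X. p u = v} \<ge> 2" using card_children[OF v] q_ge2 by simp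
  then obtain c c' where c: "c \<in> X" "p c = v" and c': "c' \<in> X" "p c' = v" "c' \<noteq> c"
    using card_le_Suc0_iff_eq[OF finite_children[OF v]] by force
  obtain x where x: "x \<in> carrier G" "\<phi> x v = c" using transitive[OF v c(1)] by blast
  have sub: "?S c \<subseteq> ?S v" using equivariant[OF _ c(1)] c(2) by auto
  \<comment> \<open>Here a second child is needed: an element taking \<open>c\<close> to
    \<open>c'\<close> fixes their parent \<open>v\<close> but not \<open>c\<close>.\<close>
  have "?S c \<noteq> ?S v"
  proof -
    obtain g where g: "g \<in> carrier G" "\<phi> g c = c'" using transitive c c' by blast
    then have "g \<in> ?S v" using equivariant[OF g(1) c(1)] c(2) c'(2) by simp
    then show ?thesis using g c'(3) by auto
  qed
  then have 1: "conj_set G x (?S v) \<subset> ?S v" using sub conj_stabilizer[OF x(1) v] x(2) by auto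
  have 2: "(\<Union>n::int. conj_set G (x [^] n) (?S v)) = kernel G integer_group shift"
  proof (intro equalityI subsetI)
    fix h assume "h \<in> (\<Union>n::int. conj_set G (x [^] n) (?S v))"
    then obtain n :: int where "h \<in> carrier G" "\<phi> h (\<phi> (x [^] n) v) = \<phi> (x [^] n) v"
      using conj_stabilizer[OF int_pow_closed[OF x(1)] v] by auto
    then show "h \<in> kernel G integer_group shift"
      using shift_eq[OF _ act_closed[OF int_pow_closed[OF x(1), of n] v], of h] by (simp add: kernel_def)
  next
    fix h assume "h \<in> kernel G integer_group shift"
    then have h: "h \<in> carrier G" "level (\<phi> h v) = level v" using shift_eq[OF _ v] by (auto simp: kernel_def)
    obtain k where k: "(p ^^ k) (\<phi> h v) = (p ^^ k) v" using merge_same_level[OF act_closed[OF h(1) v] v h(2)] by blast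
    \<comment> \<open>As \<open>x\<close> moves \<open>v\<close> to a child, it moves each proper
      ancestor of \<open>v\<close> one step back towards \<open>v\<close>. Hence conjugation by
      \<open>x^-k\<close> turns the stabiliser of \<open>v\<close> into that of
      \<open>(p ^^ k) v\<close>, and every \<open>h\<close> of shift 0 fixes such an
      ancestor.\<close>
    have "\<phi> (x [^] k) ((p ^^ k) v) = v" for k :: nat
    proof (induction k)
      case (Suc k)
      have "\<phi> x ((p ^^ Suc k) v) = (p ^^ k) v"
        using act_funpow[OF x(1) v, of "Suc k"] x(2) c(2) by (simp add: funpow_swap1)
      then show ?case
        using composition_rule[OF funpow_closed[OF v, of "Suc k"] nat_pow_closed[OF x(1), of k] x(1)] Suc by simp
    qed (simp add: act_one v)
    then have "\<phi> (x [^] (- int k)) v = (p ^^ k) v"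
      using act_inv_eq_iff[OF nat_pow_closed[OF x(1)] v funpow_closed[OF v]] x(1) by (simp add: int_pow_neg_int)
    then have "h \<in> conj_set G (x [^] (- int k)) (?S v)"
      using conj_stabilizer[OF int_pow_closed[OF x(1)] v] h(1) k act_funpow[OF h(1) v] by simp
    then show "h \<in> (\<Union>n::int. conj_set G (x [^] n) (?S v))" by blast
  qed
  show ?thesis unfolding ascending_union_of_conjugates_def
    by (rule exI[of _ "?S v"], rule exI[of _ x]) (use stabilizer_compact_open[OF v] x(1) 1 2 in blast)
qed

theorem conditions: "scale_group_conditions G T"
  unfolding scale_group_conditions_def
  using no_compact_normal open_normal_kernel ascending_union by blast

end

section \<open>The topology of pointwise convergence\<close>

abbreviation pointwise :: "'v set \<Rightarrow> ('v \<Rightarrow> 'v) topology" where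
  "pointwise V \<equiv> product_topology (\<lambda>_. discrete_topology V) V"

lemma openin_eval:
  assumes "v \<in> V" shows "openin (pointwise V) {f \<in> topspace (pointwise V). f v \<in> A}"
proof -
  have "openin (pointwise V) {f \<in> topspace (pointwise V). f v \<in> A \<inter> V}"
    by (rule openin_continuous_map_preimage[OF continuous_map_product_projection[OF assms]]) auto
  moreover have "{f \<in> topspace (pointwise V). f v \<in> A \<inter> V} = {f \<in> topspace (pointwise V). f v \<in> A}"
    using assms by auto
  ultimately show ?thesis by simp
qed

text \<open>The factors are discrete, so any condition on two coordinates is clopen. Injectivity and
  commutation with \<open>p\<close> are intersections of such conditions.\<close>

lemma closedin_eval2:
  assumes u: "u \<in> V" and v: "v \<in> V"
  shows "closedin (pointwise V) {f \<in> topspace (pointwise V). R (f u) (f v)}"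
proof -
  let ?P = "pointwise V"
  have "topspace ?P - {f \<in> topspace ?P. R (f u) (f v)} =
    (\<Union>(a, b)\<in>{(a, b). \<not> R a b}. {f \<in> topspace ?P. f u \<in> {a}} \<inter> {f \<in> topspace ?P. f v \<in> {b}})" by auto
  moreover have "openin ?P ({f \<in> topspace ?P. f u \<in> {a}} \<inter> {f \<in> topspace ?P. f v \<in> {b}})" for a b
    by (intro openin_Int openin_eval u v)
  then have "openin ?P (\<Union>(a, b)\<in>{(a, b). \<not> R a b}. {f \<in> topspace ?P. f u \<in> {a}} \<inter> {f \<in> topspace ?P. f v \<in> {b}})"
    by (intro openin_Union) (metis (no_types, lifting) imageE case_prod_beta')
  ultimately show ?thesis unfolding closedin_def by auto
qed

lemma Hausdorff_Isom_topology: "Hausdorff_space (Isom_topology V E)"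
  unfolding Isom_topology_def
  by (intro Hausdorff_space_subtopology) (simp add: Hausdorff_space_product_topology)

lemma topspace_Isom_topology: "topspace (Isom_topology V E) = carrier (Isom V E)"
  unfolding Isom_topology_def Isom_def by (auto simp: Bij_def bij_betw_def PiE_def)

lemma openin_Isom_eval:
  assumes "v \<in> V" shows "openin (Isom_topology V E) {g \<in> carrier (Isom V E). g v = w}"
proof -
  have "openin (Isom_topology V E) (carrier (Isom V E) \<inter> {f \<in> topspace (pointwise V). f v \<in> {w}})"
    unfolding Isom_topology_def using openin_eval[OF assms] openin_subtopology_Int2 by blast
  moreover have "carrier (Isom V E) \<inter> {f \<in> topspace (pointwise V). f v \<in> {w}} = {g \<in> carrier (Isom V E). g v = w}"
    by (auto simp: Isom_def Bij_def bij_betw_def PiE_def)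
  ultimately show ?thesis by simp
qed

section \<open>Compactness of vertex transporters\<close>

context parent_tree
begin

text \<open>The set is closed in a product of finite sets. Surjectivity is not visibly a closed
  condition; it follows by counting, because an injective map commuting with \<open>p\<close> sends
  the \<open>q ^ m\<close> descendants of \<open>(p ^^ n) u\<close> into the equally many
  descendants of \<open>(p ^^ n) v\<close>.\<close>

lemma compactin_automorphism_transporter:
  assumes u: "u \<in> X" and v: "v \<in> X"
  shows "compactin (pointwise X) {g \<in> Bij X. (\<forall>x\<in>X. g (p x) = p (g x)) \<and> g u = v}"
proof -
  let ?P = "pointwise X"
  \<comment> \<open>The ray from \<open>x\<close> meets that from \<open>u\<close> after
    \<open>a x\<close> and \<open>b x\<close> steps. Commutation with \<open>p\<close> then forces
    the image of \<open>x\<close> into the finite set \<open>D x\<close> of vertices that are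
    \<open>a x\<close> steps below \<open>(p ^^ b x) v\<close>.\<close>
  define a where "a x = (SOME m. \<exists>n. (p ^^ m) x = (p ^^ n) u)" for x
  define b where "b x = (SOME n. (p ^^ a x) x = (p ^^ n) u)" for x
  have ab: "(p ^^ a x) x = (p ^^ b x) u" if "x \<in> X" for x
  proof -
    have "\<exists>n. (p ^^ a x) x = (p ^^ n) u" unfolding a_def by (rule someI_ex) (rule merge[OF that u])
    then show ?thesis unfolding b_def by (rule someI_ex)
  qed
  define D where "D x = {y \<in> X. (p ^^ a x) y = (p ^^ b x) v}" for x
  define Q where "Q = {f \<in> topspace ?P. f u = v \<and> (\<forall>x\<in>X. f (p x) = p (f x)) \<and> (\<forall>x\<in>X. \<forall>y\<in>X. x \<noteq> y \<longrightarrow> f x \<noteq> f y)}"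
  have funpow: "f ((p ^^ n) x) = (p ^^ n) (f x)" if "\<And>x. x \<in> X \<Longrightarrow> f (p x) = p (f x)" "x \<in> X" for f n x
    by (induction n) (auto simp: that funpow_closed)
  have surj: "f ` X = X" if f: "f \<in> Q" for f
  proof
    have fX: "f x \<in> X" if "x \<in> X" for x using f that by (auto simp: Q_def)
    then show "f ` X \<subseteq> X" by blast
    have comm: "f ((p ^^ n) x) = (p ^^ n) (f x)" if "x \<in> X" for n x
      using funpow[of f x n] f that by (simp add: Q_def)
    show "X \<subseteq> f ` X"
    proof
      fix y assume y: "y \<in> X"
      obtain m n where mn: "(p ^^ m) y = (p ^^ n) v" using merge[OF y v] by blast
      let ?A = "{x \<in> X. (p ^^ m) x = (p ^^ n) u}" and ?B = "{x \<in> X. (p ^^ m) x = (p ^^ n) v}"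
      have A: "finite ?A \<and> card ?A = q ^ m" by (rule descendants_finite_card[OF funpow_closed[OF u]])
      have B: "finite ?B \<and> card ?B = q ^ m" by (rule descendants_finite_card[OF funpow_closed[OF v]])
      have "f ` ?A \<subseteq> ?B"
      proof
        fix z assume "z \<in> f ` ?A"
        then obtain x where x: "x \<in> X" "(p ^^ m) x = (p ^^ n) u" "z = f x" by blast
        have "(p ^^ m) z = f ((p ^^ n) u)" using comm[OF x(1), of m] x by simp
        also have "\<dots> = (p ^^ n) v" using comm[OF u] f by (simp add: Q_def)
        finally show "z \<in> ?B" using fX x by simp
      qed
      moreover have "inj_on f ?A" using f unfolding Q_def inj_on_def by blast
      ultimately have "f ` ?A = ?B" using A B by (intro card_subset_eq) (auto simp: card_image)
      then show "y \<in> f ` X" using y mn by auto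
    qed
  qed
  have eq: "{g \<in> Bij X. (\<forall>x\<in>X. g (p x) = p (g x)) \<and> g u = v} = Q"
  proof (intro equalityI subsetI)
    fix g assume "g \<in> {g \<in> Bij X. (\<forall>x\<in>X. g (p x) = p (g x)) \<and> g u = v}"
    then show "g \<in> Q" unfolding Q_def
      by (auto simp: Bij_def bij_betw_def PiE_def dest: inj_onD)
  next
    fix g assume g: "g \<in> Q"
    then have "inj_on g X" "g \<in> extensional X" unfolding Q_def inj_on_def by (auto simp: PiE_def)
    then show "g \<in> {g \<in> Bij X. (\<forall>x\<in>X. g (p x) = p (g x)) \<and> g u = v}"
      using g surj[OF g] by (auto simp: Q_def Bij_def bij_betw_def)
  qed
  have "Q = {f \<in> topspace ?P. f u = v} \<inter> (\<Inter>x\<in>X. {f \<in> topspace ?P. f (p x) = p (f x)}) \<inter>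
     (\<Inter>x\<in>X. \<Inter>y\<in>X. {f \<in> topspace ?P. x \<noteq> y \<longrightarrow> f x \<noteq> f y})" (is "Q = ?R")
    unfolding Q_def using nonempty by blast
  moreover have "closedin ?P ?R"
    using closedin_eval2[OF u u, of "\<lambda>a b. a = v"] closedin_eval2[OF parent_closed, of _ _ "\<lambda>a b. a = p b"]
      closedin_eval2[of _ X _ "\<lambda>a b. _ \<longrightarrow> a \<noteq> b"] nonempty
    by (intro closedin_Int closedin_INT) auto
  ultimately have "closedin ?P Q" by simp
  moreover have "compactin ?P (Pi\<^sub>E X D)"
    using descendants_finite_card[OF funpow_closed[OF v]] by (auto simp: compactin_PiE compactin_discrete_topology D_def)
  moreover have "Q \<subseteq> Pi\<^sub>E X D"
  proof
    fix f assume f: "f \<in> Q"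
    have "f x \<in> D x" if x: "x \<in> X" for x
    proof -
      have comm: "f ((p ^^ n) x) = (p ^^ n) (f x)" if "x \<in> X" for n x
        using funpow[of f x n] f that by (simp add: Q_def)
      have "(p ^^ a x) (f x) = f ((p ^^ b x) u)" using comm[OF x] ab[OF x] by metis
      also have "\<dots> = (p ^^ b x) v" using comm[OF u] f by (simp add: Q_def)
      finally show ?thesis using f x by (auto simp: D_def Q_def)
    qed
    then show "f \<in> Pi\<^sub>E X D" using f by (auto simp: Q_def PiE_def)
  qed
  ultimately show ?thesis unfolding eq using closed_compactin by blast
qed

text \<open>A transporter inside \<open>P\<close> is the intersection of \<open>P\<close> with the
  compact transporter in the full stabiliser of the end; here it matters that a scale group is
  closed.\<close>

lemma scale_group_tree_action:
  assumes Iso: "Isom_end X E \<omega> = {g \<in> Bij X. \<forall>v\<in>X. g (p v) = p (g v)}"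
    and G: "group G" "topspace T = carrier G"
    and iso: "isomorphic_to_scale_group G T X E \<omega>"
  shows "\<exists>\<phi>. tree_action q X p G \<phi> T"
proof -
  obtain P f where P: "scale_group X E \<omega> P"
    and f: "f \<in> iso G ((Isom X E)\<lparr>carrier := P\<rparr>)" and h: "homeomorphic_map T (subtopology (Isom_topology X E) P) f"
    using iso unfolding isomorphic_to_scale_group_def top_group_isomorphic_def by blast
  have Pend: "P \<subseteq> Isom_end X E \<omega>" and Pcl: "closedin (Isom_topology X E) P"
    and Ptr: "\<And>u v. u \<in> X \<Longrightarrow> v \<in> X \<Longrightarrow> \<exists>g\<in>P. g u = v"
    using P by (auto simp: scale_group_def)
  have endI: "Isom_end X E \<omega> \<subseteq> carrier (Isom X E)" by (auto simp: Isom_end_def)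
  have fP: "f ` carrier G = P" and finj: "inj_on f (carrier G)" using f by (auto simp: iso_def bij_betw_def)
  have fin: "f g \<in> P" if "g \<in> carrier G" for g using fP that by blast
  have PB: "g \<in> Bij X" "v \<in> X \<Longrightarrow> g (p v) = p (g v)" if "g \<in> P" for g v using Pend Iso that by auto
  have img: "f ` {g \<in> carrier G. f g u = v} = P \<inter> {g \<in> carrier (Isom X E). g u = v}" for u v
    using fP Pend endI by auto
  have "tree_action q X p G f T"
  proof (intro tree_action.intro tree_action_axioms.intro)
    show "parent_tree q X p" by (rule parent_tree_axioms)
    show "group_action G X f"
    proof (rule group_actionI[OF G(1)])
      show "f g \<in> Bij X" if "g \<in> carrier G" for g using PB(1)[OF fin[OF that]] .
      show "f (g \<otimes>\<^bsub>G\<^esub> h) = compose X (f g) (f h)" if "g \<in> carrier G" "h \<in> carrier G" for g h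
        using f that PB(1)[OF fin] by (auto simp: iso_def hom_def Isom_def BijGroup_def)
    qed
    show "f g (p v) = p (f g v)" if "g \<in> carrier G" "v \<in> X" for g v using PB(2)[OF fin] that by blast
    show "\<exists>g\<in>carrier G. f g u = v" if "u \<in> X" "v \<in> X" for u v
      using Ptr[OF that] fP by blast
    show "inj_on f (carrier G)" by fact
    fix u v assume uv: "u \<in> X" "v \<in> X"
    have sub: "{g \<in> carrier G. f g u = v} \<subseteq> topspace T" using G by auto
    have "openin (subtopology (Isom_topology X E) P) (f ` {g \<in> carrier G. f g u = v})"
      unfolding img using openin_Isom_eval[OF uv(1)] openin_subtopology_Int2 by blast
    then show "openin T {g \<in> carrier G. f g u = v}" using homeomorphic_map_openness[OF h sub] by blast
    let ?Q = "{g \<in> Bij X. (\<forall>x\<in>X. g (p x) = p (g x)) \<and> g u = v}"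
    have "?Q \<subseteq> carrier (Isom X E)" using Iso endI by auto
    then have "compactin (Isom_topology X E) ?Q"
      unfolding Isom_topology_def using compactin_automorphism_transporter[OF uv] by (simp add: compactin_subtopology)
    then have "compactin (Isom_topology X E) (P \<inter> ?Q)" using closed_Int_compactin[OF Pcl] by blast
    moreover have "P \<inter> ?Q = P \<inter> {g \<in> carrier (Isom X E). g u = v}" using Pend Iso endI by auto
    ultimately have "compactin (subtopology (Isom_topology X E) P) (f ` {g \<in> carrier G. f g u = v})"
      unfolding img by (simp add: compactin_subtopology)
    then show "compactin T {g \<in> carrier G. f g u = v}" using homeomorphic_map_compactness[OF h sub] by blast
  qed
  then show ?thesis by blast
qed

end

text \<open>The key is that \<phi> is a closed map into all automorphisms of the tree: applied to
  the whole group this shows that the image is closed, and applied to all closed sets it gives the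
  homeomorphism.\<close>

lemma (in tree_action) isomorphic_to_scale_groupI:
  assumes Iso: "Isom_end X E \<omega> = {g \<in> Bij X. \<forall>v\<in>X. g (p v) = p (g v)}"
    and T: "topspace T = carrier G"
  shows "isomorphic_to_scale_group G T X E \<omega>"
proof -
  let ?I = "Isom_topology X E" and ?P = "\<phi> ` carrier G"
  obtain v where v: "v \<in> X" using nonempty by blast
  have PI: "?P \<subseteq> Isom_end X E \<omega>" using Iso bij_prop0 equivariant by auto
  have endI: "Isom_end X E \<omega> \<subseteq> carrier (Isom X E)" by (auto simp: Isom_end_def)
  have PC: "?P \<subseteq> carrier (Isom X E)" using PI endI by blast
  have "continuous_map T (pointwise X) \<phi>"
    unfolding continuous_map_componentwise
  proof (intro conjI ballI)
    show "\<phi> ` topspace T \<subseteq> extensional X" using T bij_prop0 by (auto simp: Bij_def)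
    fix u assume u: "u \<in> X"
    have "openin T {g \<in> topspace T. \<phi> g u \<in> U}" if "U \<subseteq> X" for U
    proof -
      have "{g \<in> topspace T. \<phi> g u \<in> U} = \<Union>((\<lambda>w. {g \<in> carrier G. \<phi> g u = w}) ` U)" using T by auto
      then show ?thesis using open_transporter[OF u] that by (auto intro!: openin_Union)
    qed
    then show "continuous_map T (discrete_topology X) (\<lambda>g. \<phi> g u)"
      using act_closed[OF _ u] T by (auto simp: continuous_map_def)
  qed
  then have cont: "continuous_map T ?I \<phi>"
    unfolding Isom_topology_def using PC T by (auto simp: continuous_map_in_subtopology)
  have closed: "closedin ?I (\<phi> ` C)" if C: "closedin T C" for C
  proof -
    have CG: "C \<subseteq> carrier G" using closedin_subset[OF C] T by simp
    have "openin ?I (topspace ?I - \<phi> ` C)"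
    proof (subst openin_subopen, intro ballI)
      fix \<beta> assume \<beta>: "\<beta> \<in> topspace ?I - \<phi> ` C"
      \<comment> \<open>Near \<beta> only maps taking \<open>v\<close> to \<open>w\<close> matter.
        There the image of \<open>C\<close> is the image of \<open>C\<close> cut with a compact
        transporter, hence compact and therefore closed.\<close>
      define w where "w = \<beta> v"
      have w: "w \<in> X" using \<beta> v by (auto simp: w_def topspace_Isom_topology Isom_def Bij_def bij_betw_def)
      let ?A = "{g \<in> carrier G. \<phi> g v = w}" and ?N = "{g \<in> carrier (Isom X E). g v = w}"
      have "compactin ?I (\<phi> ` (C \<inter> ?A))"
        by (rule image_compactin[OF closed_Int_compactin[OF C compact_transporter[OF v w]] cont])
      then have "closedin ?I (\<phi> ` (C \<inter> ?A))" by (rule compactin_imp_closedin[OF Hausdorff_Isom_topology])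
      then have "openin ?I (?N - \<phi> ` (C \<inter> ?A))" by (rule openin_diff[OF openin_Isom_eval[OF v]])
      moreover have "\<beta> \<in> ?N - \<phi> ` (C \<inter> ?A)" using \<beta> by (auto simp: w_def topspace_Isom_topology)
      moreover have "?N - \<phi> ` (C \<inter> ?A) \<subseteq> topspace ?I - \<phi> ` C" using CG by (auto simp: topspace_Isom_topology)
      ultimately show "\<exists>U. openin ?I U \<and> \<beta> \<in> U \<and> U \<subseteq> topspace ?I - \<phi> ` C" by blast
    qed
    moreover have "\<phi> ` C \<subseteq> topspace ?I" using CG PC by (auto simp: topspace_Isom_topology)
    ultimately show ?thesis by (simp add: closedin_def)
  qed
  have "closedin ?I ?P" using closed[of "carrier G"] T by (metis closedin_topspace)
  moreover have "subgroup ?P (Isom X E)"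
  proof -
    have "subgroup ?P (BijGroup X)" using group_hom.img_is_subgroup[OF group_hom] .
    moreover have "subgroup (carrier (Isom X E)) (BijGroup X)"
    proof -
      interpret B: group "BijGroup X" by (rule group_BijGroup)
      show ?thesis
      proof (rule B.subgroupI)
        show "carrier (Isom X E) \<subseteq> carrier (BijGroup X)" by (auto simp: Isom_def BijGroup_def)
        show "carrier (Isom X E) \<noteq> {}" using PC by auto
        fix a assume a: "a \<in> carrier (Isom X E)"
        then have aB: "a \<in> Bij X" by (simp add: Isom_def)
        have inv: "inv\<^bsub>BijGroup X\<^esub> a = (\<lambda>x\<in>X. inv_into X a x)" using inv_BijGroup[OF aB] .
        have *: "inv_into X a x \<in> X" "a (inv_into X a x) = x" if "x \<in> X" for x
          using aB that by (auto simp: Bij_def bij_betw_def inv_into_into f_inv_into_f)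
        have "(inv_into X a x, inv_into X a y) \<in> E \<longleftrightarrow> (x, y) \<in> E" if "x \<in> X" "y \<in> X" for x y
        proof -
          have "(a (inv_into X a x), a (inv_into X a y)) \<in> E \<longleftrightarrow> (inv_into X a x, inv_into X a y) \<in> E"
            using a *(1)[OF that(1)] *(1)[OF that(2)] by (simp add: Isom_def)
          then show ?thesis unfolding *(2)[OF that(1)] *(2)[OF that(2)] by simp
        qed
        then show "inv\<^bsub>BijGroup X\<^esub> a \<in> carrier (Isom X E)"
          unfolding inv using restrict_inv_into_Bij[OF aB] by (simp add: Isom_def)
        fix b assume b: "b \<in> carrier (Isom X E)"
        have bX: "b x \<in> X" if "x \<in> X" for x using b that by (auto simp: Isom_def Bij_def bij_betw_def)
        show "a \<otimes>\<^bsub>BijGroup X\<^esub> b \<in> carrier (Isom X E)"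
          using a b bX by (auto simp: Isom_def BijGroup_def compose_Bij compose_eq)
      qed
    qed
    ultimately have "subgroup ?P ((BijGroup X)\<lparr>carrier := carrier (Isom X E)\<rparr>)"
      using group.subgroup_incl[OF group_BijGroup] PC by blast
    then show ?thesis by (simp add: Isom_def)
  qed
  moreover have "\<forall>u\<in>X. \<forall>v\<in>X. \<exists>g\<in>?P. g u = v" using transitive by blast
  ultimately have P: "scale_group X E \<omega> ?P" using PI by (simp add: scale_group_def)
  have "\<phi> \<in> hom G (BijGroup X)" using group_hom by (simp add: group_hom_def group_hom_axioms_def)
  then have "\<phi> \<in> iso G ((Isom X E)\<lparr>carrier := ?P\<rparr>)"
    using faithful by (auto simp: iso_def hom_def Isom_def bij_betw_def)
  moreover have "homeomorphic_map T (subtopology ?I ?P) \<phi>"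
  proof (rule bijective_closed_imp_homeomorphic_map)
    show "continuous_map T (subtopology ?I ?P) \<phi>" using cont T by (auto simp: continuous_map_in_subtopology)
    show "closed_map T (subtopology ?I ?P) \<phi>"
      by (rule closed_map_into_subtopology) (use closed T in \<open>auto simp: closed_map_def\<close>)
    show "\<phi> ` topspace T = topspace (subtopology ?I ?P)" using T PC by (auto simp: topspace_Isom_topology)
    show "inj_on \<phi> (topspace T)" using faithful T by simp
  qed
  ultimately show ?thesis using P unfolding isomorphic_to_scale_group_def top_group_isomorphic_def by blast
qed

section \<open>Conjugation and indices of subgroups\<close>

definition conj_elt :: "('a, 'm) monoid_scheme \<Rightarrow> 'a \<Rightarrow> 'a \<Rightarrow> 'a" where
  "conj_elt G x u = x \<otimes>\<^bsub>G\<^esub> u \<otimes>\<^bsub>G\<^esub> inv\<^bsub>G\<^esub> x"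

lemma conj_set_eq_image: "conj_set G x U = conj_elt G x ` U"
  by (simp add: conj_set_def conj_elt_def cong: image_cong)

context group
begin

lemma conj_elt_closed [simp]: "x \<in> carrier G \<Longrightarrow> u \<in> carrier G \<Longrightarrow> conj_elt G x u \<in> carrier G"
  by (simp add: conj_elt_def)

lemma conj_elt_conj_elt:
  "x \<in> carrier G \<Longrightarrow> y \<in> carrier G \<Longrightarrow> u \<in> carrier G \<Longrightarrow>
    conj_elt G x (conj_elt G y u) = conj_elt G (x \<otimes> y) u"
  by (simp add: conj_elt_def m_assoc inv_mult_group)

lemma conj_elt_one [simp]: "u \<in> carrier G \<Longrightarrow> conj_elt G \<one> u = u"
  by (simp add: conj_elt_def)

lemma conj_elt_inv [simp]:
  assumes "x \<in> carrier G" "u \<in> carrier G"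
  shows "conj_elt G (inv x) (conj_elt G x u) = u" "conj_elt G x (conj_elt G (inv x) u) = u"
  using assms by (simp_all add: conj_elt_conj_elt)

lemma conj_elt_mult:
  "x \<in> carrier G \<Longrightarrow> u \<in> carrier G \<Longrightarrow> v \<in> carrier G \<Longrightarrow>
    conj_elt G x (u \<otimes> v) = conj_elt G x u \<otimes> conj_elt G x v"
  by (simp add: conj_elt_def m_assoc mult_inv_cancel)

lemma conj_set_subset: "x \<in> carrier G \<Longrightarrow> U \<subseteq> carrier G \<Longrightarrow> conj_set G x U \<subseteq> carrier G"
  by (auto simp: conj_set_eq_image)

lemma mem_conj_set_iff:
  assumes "x \<in> carrier G" "U \<subseteq> carrier G" "u \<in> carrier G"
  shows "u \<in> conj_set G x U \<longleftrightarrow> conj_elt G (inv x) u \<in> U"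
  using assms unfolding conj_set_eq_image by (force intro!: image_eqI[of _ _ "conj_elt G (inv x) u"])

lemma conj_set_conj_set:
  "x \<in> carrier G \<Longrightarrow> y \<in> carrier G \<Longrightarrow> U \<subseteq> carrier G \<Longrightarrow>
    conj_set G x (conj_set G y U) = conj_set G (x \<otimes> y) U"
  unfolding conj_set_eq_image image_image by (rule image_cong) (auto simp: conj_elt_conj_elt)

lemma conj_set_one: "U \<subseteq> carrier G \<Longrightarrow> conj_set G \<one> U = U"
  unfolding conj_set_eq_image by force

lemma inj_on_conj_elt: "x \<in> carrier G \<Longrightarrow> inj_on (conj_elt G x) (carrier G)"
  by (metis conj_elt_inv(1) inj_onI)

lemma conj_set_Int:
  "x \<in> carrier G \<Longrightarrow> A \<subseteq> carrier G \<Longrightarrow> B \<subseteq> carrier G \<Longrightarrow>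
    conj_set G x (A \<inter> B) = conj_set G x A \<inter> conj_set G x B"
  unfolding conj_set_eq_image using inj_on_image_Int[OF inj_on_conj_elt] by blast

lemma subgroup_conj_set:
  assumes x: "x \<in> carrier G" and U: "subgroup U G" shows "subgroup (conj_set G x U) G"
proof -
  have "group_hom G G (conj_elt G x)"
    by (intro group_hom.intro group_hom_axioms.intro is_group) (auto simp: hom_def x conj_elt_mult)
  from group_hom.subgroup_img_is_subgroup[OF this U] show ?thesis by (simp add: conj_set_eq_image)
qed

lemma conj_set_subgroup_self:
  assumes U: "subgroup U G" and u: "u \<in> U" shows "conj_set G u U = U"
proof -
  interpret U: subgroup U G by fact
  have "conj_elt G u v \<in> U" if "v \<in> U" for v using u that by (simp add: conj_elt_def)
  moreover have "v \<in> conj_set G u U" if "v \<in> U" for v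
    using mem_conj_set_iff[of u U v] U.subset u that by (auto simp: conj_elt_def)
  ultimately show ?thesis by (auto simp: conj_set_eq_image)
qed

lemma rcosets_restrict: "rcosets\<^bsub>G\<lparr>carrier := A\<rparr>\<^esub> B = (\<lambda>a. B #> a) ` A"
  by (auto simp: RCOSETS_def)

lemma subgroup_index_conj:
  assumes x: "x \<in> carrier G" and A: "A \<subseteq> carrier G" and B: "B \<subseteq> carrier G"
  shows "subgroup_index G (conj_set G x A) (conj_set G x B) = subgroup_index G A B"
proof -
  have "conj_set G x B #> conj_elt G x a = conj_set G x (B #> a)" if "a \<in> A" for a
  proof -
    have "conj_elt G x b \<otimes> conj_elt G x a = conj_elt G x (b \<otimes> a)" if "b \<in> B" for b
      using conj_elt_mult[of x b a] x subsetD[OF A \<open>a \<in> A\<close>] subsetD[OF B that] by simp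
    then show ?thesis unfolding r_coset_def conj_set_eq_image by auto
  qed
  then have "(\<lambda>a. conj_set G x B #> a) ` conj_set G x A = conj_set G x ` (\<lambda>a. B #> a) ` A"
    by (force simp: conj_set_eq_image[of G x A] image_image)
  moreover have "inj_on (conj_set G x) ((\<lambda>a. B #> a) ` A)"
  proof (rule inj_onI)
    fix C D assume "C \<in> (\<lambda>a. B #> a) ` A" "D \<in> (\<lambda>a. B #> a) ` A" "conj_set G x C = conj_set G x D"
    moreover from this have "C \<subseteq> carrier G" "D \<subseteq> carrier G" using A B r_coset_subset_G by blast+
    ultimately show "C = D" using conj_set_conj_set[of "inv x" x] x conj_set_one by (metis inv_closed l_inv)
  qed
  ultimately show ?thesis unfolding subgroup_index_def rcosets_restrict by (simp add: card_image)
qed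

text \<open>The cosets of \<open>C\<close> in \<open>A\<close> are sorted by the coset
  \<open>B #> a\<close> that contains them. Each class is the translate by \<open>a\<close> of the
  set of cosets of \<open>C\<close> in \<open>B\<close>.\<close>

lemma subgroup_index_mult:
  assumes A: "subgroup A G" and B: "subgroup B G" and C: "subgroup C G" and BA: "B \<subseteq> A" and CB: "C \<subseteq> B"
    and finAB: "finite ((\<lambda>a. B #> a) ` A)" and finBC: "finite ((\<lambda>a. C #> a) ` B)"
  shows "subgroup_index G A C = subgroup_index G A B * subgroup_index G B C"
proof -
  interpret A: subgroup A G by fact
  interpret B: subgroup B G by fact
  interpret C: subgroup C G by fact
  let ?F = "\<lambda>D. (\<lambda>d. C #> d) ` D"
  have D: "?F (B #> a) = (\<lambda>S. S #> a) ` (\<lambda>b. C #> b) ` B" if "a \<in> A" for a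
    using that A.subset B.subset C.subset by (force simp: r_coset_def[of G B] image_image coset_mult_assoc)
  have inj: "inj_on (\<lambda>S. S #> a) ((\<lambda>b. C #> b) ` B)" if "a \<in> A" for a
  proof (rule inj_onI)
    fix S S' assume S: "S \<in> (\<lambda>b. C #> b) ` B" "S' \<in> (\<lambda>b. C #> b) ` B" "S #> a = S' #> a"
    moreover have "C #> b \<subseteq> carrier G" if "b \<in> B" for b
      by (rule r_coset_subset_G) (use that B.subset C.subset in auto)
    ultimately have "S \<subseteq> carrier G" "S' \<subseteq> carrier G" by auto
    moreover have "R #> a #> inv a = R" if "R \<subseteq> carrier G" for R
      using that subsetD[OF A.subset \<open>a \<in> A\<close>] by (simp add: coset_mult_assoc)
    ultimately show "S = S'" using S(3) by metis
  qed
  have "(\<lambda>a. C #> a) ` A = (\<Union>D\<in>(\<lambda>a. B #> a) ` A. ?F D)"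
  proof (intro equalityI subsetI)
    fix S assume "S \<in> (\<lambda>a. C #> a) ` A"
    then obtain a where "a \<in> A" "S = C #> a" by blast
    then show "S \<in> (\<Union>D\<in>(\<lambda>a. B #> a) ` A. ?F D)" using rcos_self[OF _ B] A.subset by blast
  next
    fix S assume "S \<in> (\<Union>D\<in>(\<lambda>a. B #> a) ` A. ?F D)"
    then obtain a d where "a \<in> A" "d \<in> B #> a" "S = C #> d" by blast
    then show "S \<in> (\<lambda>a. C #> a) ` A" using BA A.m_closed unfolding r_coset_def by blast
  qed
  also have "card \<dots> = (\<Sum>D\<in>(\<lambda>a. B #> a) ` A. card (?F D))"
  proof (rule card_UN_disjoint)
    show "\<forall>D\<in>(\<lambda>a. B #> a) ` A. finite (?F D)" using D finBC by auto
    show "\<forall>D\<in>(\<lambda>a. B #> a) ` A. \<forall>D'\<in>(\<lambda>a. B #> a) ` A. D \<noteq> D' \<longrightarrow> ?F D \<inter> ?F D' = {}"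
    proof (intro ballI impI, rule ccontr)
      fix D D' assume D: "D \<in> (\<lambda>a. B #> a) ` A" "D' \<in> (\<lambda>a. B #> a) ` A" "D \<noteq> D'" "?F D \<inter> ?F D' \<noteq> {}"
      then obtain a a' d d' where *: "a \<in> A" "a' \<in> A" "D = B #> a" "D' = B #> a'" "d \<in> D" "d' \<in> D'" "C #> d = C #> d'" by blast
      have dG: "d \<in> carrier G" "d' \<in> carrier G" using * A.subset B.subset r_coset_subset_G by blast+
      have "d \<in> C #> d'" using rcos_self[OF dG(1) C] *(7) by simp
      then have "d \<in> B #> d'" using CB by (auto simp: r_coset_def)
      moreover have "B #> d = D" "B #> d' = D'" using * repr_independence B A.subset by blast+
      ultimately have "D = D'" using repr_independence[OF _ dG(2) B] by blast
      then show False using D by blast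
    qed
  qed (use finAB in auto)
  also have "\<dots> = (\<Sum>D\<in>(\<lambda>a. B #> a) ` A. subgroup_index G B C)"
    by (rule sum.cong) (use D inj in \<open>auto simp: card_image subgroup_index_def rcosets_restrict\<close>)
  finally show ?thesis by (simp add: subgroup_index_def rcosets_restrict)
qed

lemma subgroup_index_self: assumes "subgroup A G" shows "subgroup_index G A A = 1"
proof -
  interpret A: subgroup A G by fact
  have "A #> a = A" if "a \<in> A" for a using coset_join2[OF _ assms that] A.subset that by blast
  then have "(\<lambda>a. A #> a) ` A = (\<lambda>a. A) ` A" by (rule image_cong[OF refl])
  then have "(\<lambda>a. A #> a) ` A = {A}" using A.one_closed by (simp add: image_constant)
  then show ?thesis by (simp add: subgroup_index_def rcosets_restrict)
qed

lemma subgroup_index_eq_1_imp: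
  assumes A: "subgroup A G" and B: "subgroup B G" and "B \<subseteq> A" and 1: "subgroup_index G A B = 1"
  shows "A = B"
proof -
  interpret A: subgroup A G by fact
  interpret B: subgroup B G by fact
  obtain S where S: "(\<lambda>a. B #> a) ` A = {S}" using 1 card_1_singletonE by (auto simp: subgroup_index_def rcosets_restrict)
  have "a \<in> B" if "a \<in> A" for a
  proof -
    have "B #> a = B #> \<one>" using S that A.one_closed by blast
    then show ?thesis using coset_join1[of B a] B that A.subset B.subset coset_mult_one by auto
  qed
  then show ?thesis using assms(3) by blast
qed

end

section \<open>Compact open subgroups\<close>

locale top_group = group G for G :: "('a, 'm) monoid_scheme" (structure) +
  fixes T :: "'a topology"
  assumes topspace: "topspace T = carrier G"
    and continuous_mult: "continuous_map (prod_topology T T) T (\<lambda>(x, y). x \<otimes> y)"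
    and Hausdorff: "Hausdorff_space T"
begin

lemma continuous_left: "a \<in> carrier G \<Longrightarrow> continuous_map T T (\<lambda>x. a \<otimes> x)"
  using continuous_map_compose[OF continuous_map_pairedI[of T T "\<lambda>_. a" T "\<lambda>x. x"] continuous_mult]
  by (simp add: o_def topspace)

lemma continuous_right: "a \<in> carrier G \<Longrightarrow> continuous_map T T (\<lambda>x. x \<otimes> a)"
  using continuous_map_compose[OF continuous_map_pairedI[of T T "\<lambda>x. x" T "\<lambda>_. a"] continuous_mult]
  by (simp add: o_def topspace)

lemma open_right_translate:
  assumes a: "a \<in> carrier G" and U: "openin T U" shows "openin T ((\<lambda>x. x \<otimes> a) ` U)"
proof -
  have UG: "U \<subseteq> carrier G" using openin_subset[OF U] topspace by simp
  have "(\<lambda>x. x \<otimes> a) ` U = {y \<in> topspace T. y \<otimes> inv a \<in> U}"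
    using a UG by (force simp: topspace m_assoc intro!: image_eqI[of _ _ "_ \<otimes> inv a"])
  then show ?thesis using openin_continuous_map_preimage[OF continuous_right U] a by simp
qed

lemma open_left_translate:
  assumes a: "a \<in> carrier G" and U: "openin T U" shows "openin T ((\<lambda>x. a \<otimes> x) ` U)"
proof -
  have UG: "U \<subseteq> carrier G" using openin_subset[OF U] topspace by simp
  have "(\<lambda>x. a \<otimes> x) ` U = {y \<in> topspace T. inv a \<otimes> y \<in> U}"
    using a UG by (force simp: topspace mult_inv_cancel intro!: image_eqI[of _ _ "inv a \<otimes> _"])
  then show ?thesis using openin_continuous_map_preimage[OF continuous_left U] a by simp
qed

lemma compact_open_conj:
  assumes x: "x \<in> carrier G" and U: "compact_open_subgroup G T U"
  shows "compact_open_subgroup G T (conj_set G x U)"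
proof -
  have "conj_set G x U = (\<lambda>y. y \<otimes> inv x) ` (\<lambda>u. x \<otimes> u) ` U" by (auto simp: conj_set_def)
  moreover have "compactin T ((\<lambda>y. y \<otimes> inv x) ` (\<lambda>u. x \<otimes> u) ` U)" "openin T ((\<lambda>y. y \<otimes> inv x) ` (\<lambda>u. x \<otimes> u) ` U)"
    using U x unfolding compact_open_subgroup_def
    by (auto intro!: open_right_translate open_left_translate image_compactin continuous_left continuous_right)
  ultimately have "compactin T (conj_set G x U)" "openin T (conj_set G x U)" by simp_all
  then show ?thesis
    using U x subgroup_conj_set by (auto simp: compact_open_subgroup_def)
qed

lemma compact_open_Int:
  "compact_open_subgroup G T U \<Longrightarrow> compact_open_subgroup G T V \<Longrightarrow> compact_open_subgroup G T (U \<inter> V)"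
  unfolding compact_open_subgroup_def
  using compactin_Int[OF Hausdorff] openin_Int subgroups_Inter_pair by blast

text \<open>The cosets are open and pairwise disjoint, so a finite subcover of \<open>A\<close>
  already contains every coset that meets \<open>A\<close>.\<close>

lemma finite_rcosets:
  assumes A: "compactin T A" and B: "openin T B" "subgroup B G"
  shows "finite ((\<lambda>a. B #> a) ` A)"
proof -
  have AG: "A \<subseteq> carrier G" using compactin_subset_topspace[OF A] topspace by simp
  have "openin T (B #> a)" if "a \<in> A" for a
  proof -
    have "B #> a = (\<lambda>x. x \<otimes> a) ` B" by (auto simp: r_coset_def)
    then show ?thesis using open_right_translate[OF _ B(1), of a] that AG by auto
  qed
  moreover have "A \<subseteq> \<Union>((\<lambda>a. B #> a) ` A)" using rcos_self[OF _ B(2)] AG by blast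
  ultimately obtain \<F> where \<F>: "finite \<F>" "\<F> \<subseteq> (\<lambda>a. B #> a) ` A" "A \<subseteq> \<Union>\<F>"
    using compactinD[OF A, of "(\<lambda>a. B #> a) ` A"] by auto
  have "B #> a \<in> \<F>" if a: "a \<in> A" for a
  proof -
    obtain D where D: "D \<in> \<F>" "a \<in> D" using \<F>(3) a by blast
    then obtain b where b: "b \<in> A" "D = B #> b" using \<F>(2) by blast
    then have "B #> a = D" using repr_independence[of a B b] AG B(2) D(2) by auto
    then show ?thesis using D(1) by simp
  qed
  then have "(\<lambda>a. B #> a) ` A \<subseteq> \<F>" by (rule image_subsetI)
  then show ?thesis using \<F>(1) by (rule finite_subset)
qed

section \<open>Commensurability indices and the modular function\<close>

lemma subgroup_index_pos:
  assumes "compact_open_subgroup G T A" "compact_open_subgroup G T B"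
  shows "subgroup_index G A B > 0"
proof -
  have "finite ((\<lambda>a. B #> a) ` A)" using finite_rcosets assms by (auto simp: compact_open_subgroup_def)
  moreover have "A \<noteq> {}" using assms(1) by (auto simp: compact_open_subgroup_def dest: subgroup.one_closed)
  ultimately show ?thesis by (simp add: subgroup_index_def rcosets_restrict card_gt_0_iff)
qed

text \<open>\<open>rel_index (conj_set G y U) U\<close> is the modular function at \<open>y\<close>, obtained without Haar measure.\<close>

definition rel_index :: "'a set \<Rightarrow> 'a set \<Rightarrow> real" where
  "rel_index A B = subgroup_index G A (A \<inter> B) / subgroup_index G B (A \<inter> B)"

text \<open>The common factor \<open>[A \<inter> B : K]\<close> cancels. So three subgroups can be
  compared through one intersection, which yields the cocycle rule
  \<open>rel_index_trans\<close>.\<close>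

lemma rel_index_eq:
  assumes A: "compact_open_subgroup G T A" and B: "compact_open_subgroup G T B"
    and K: "compact_open_subgroup G T K" "K \<subseteq> A \<inter> B"
  shows "rel_index A B = subgroup_index G A K / subgroup_index G B K"
proof -
  note AB = compact_open_Int[OF A B]
  have mult: "subgroup_index G D K = subgroup_index G D (A \<inter> B) * subgroup_index G (A \<inter> B) K"
    if D: "compact_open_subgroup G T D" "A \<inter> B \<subseteq> D" for D
    by (rule subgroup_index_mult) (use D AB K in \<open>auto simp: compact_open_subgroup_def intro!: finite_rcosets\<close>)
  show ?thesis using mult[OF A] mult[OF B] subgroup_index_pos[OF AB K(1)] by (simp add: rel_index_def)
qed

lemma rel_index_trans:
  assumes A: "compact_open_subgroup G T A" and B: "compact_open_subgroup G T B" and C: "compact_open_subgroup G T C"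
  shows "rel_index A B * rel_index B C = rel_index A C"
proof -
  let ?K = "A \<inter> B \<inter> C"
  have K: "compact_open_subgroup G T ?K" by (intro compact_open_Int A B C)
  have "rel_index A B = subgroup_index G A ?K / subgroup_index G B ?K" by (rule rel_index_eq[OF A B K]) auto
  moreover have "rel_index B C = subgroup_index G B ?K / subgroup_index G C ?K" by (rule rel_index_eq[OF B C K]) auto
  moreover have "rel_index A C = subgroup_index G A ?K / subgroup_index G C ?K" by (rule rel_index_eq[OF A C K]) auto
  ultimately show ?thesis using subgroup_index_pos[OF B K] by simp
qed

lemma rel_index_self: "compact_open_subgroup G T A \<Longrightarrow> rel_index A A = 1"
  by (simp add: rel_index_def subgroup_index_self compact_open_subgroup_def)

lemma compact_open_subset: "compact_open_subgroup G T A \<Longrightarrow> A \<subseteq> carrier G"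
  by (auto simp: compact_open_subgroup_def dest: subgroup.subset)

lemma rel_index_conj:
  assumes "x \<in> carrier G" "compact_open_subgroup G T A" "compact_open_subgroup G T B"
  shows "rel_index (conj_set G x A) (conj_set G x B) = rel_index A B"
proof -
  note s = compact_open_subset[OF assms(2)] compact_open_subset[OF assms(3)]
  then have "A \<inter> B \<subseteq> carrier G" by blast
  then show ?thesis
    by (simp add: rel_index_def subgroup_index_conj[OF assms(1)] s flip: conj_set_Int[OF assms(1) s])
qed

text \<open>Pass from \<open>yUy^-1\<close> to \<open>yWy^-1\<close>, then to \<open>W\<close>, then
  to \<open>U\<close>. The first factor equals the ratio of \<open>U\<close> to \<open>W\<close> by
  conjugation invariance and cancels against the last.\<close>

lemma rel_index_conj_indep:
  assumes y: "y \<in> carrier G" and U: "compact_open_subgroup G T U" and W: "compact_open_subgroup G T W"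
  shows "rel_index (conj_set G y U) U = rel_index (conj_set G y W) W"
proof -
  note yU = compact_open_conj[OF y U] and yW = compact_open_conj[OF y W]
  have "rel_index (conj_set G y U) U = rel_index U W * rel_index (conj_set G y W) U"
    using rel_index_trans[OF yU yW U] rel_index_conj[OF y U W] by simp
  also have "\<dots> = rel_index U W * rel_index W U * rel_index (conj_set G y W) W"
    using rel_index_trans[OF yW W U] by (simp add: mult.assoc mult.commute)
  finally show ?thesis using rel_index_trans[OF U W U] rel_index_self[OF U] by simp
qed

lemma rel_index_conj_mult:
  assumes y: "y \<in> carrier G" and z: "z \<in> carrier G" and U: "compact_open_subgroup G T U"
  shows "rel_index (conj_set G (y \<otimes> z) U) U = rel_index (conj_set G y U) U * rel_index (conj_set G z U) U"
proof -
  have "rel_index (conj_set G (y \<otimes> z) U) (conj_set G y U) = rel_index (conj_set G z U) U"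
    using rel_index_conj[OF y compact_open_conj[OF z U] U] conj_set_conj_set[OF y z compact_open_subset[OF U]] by simp
  then show ?thesis
    using rel_index_trans[OF compact_open_conj[OF m_closed[OF y z] U] compact_open_conj[OF y U] U]
    by (simp add: mult.commute)
qed

end

section \<open>Groups with a contracting element\<close>

text \<open>The normal form of (2) and (3): \<eta> is the projection to the integers,
  \<open>H\<close> survives only as its kernel, and \<open>absorb\<close> says that the conjugates
  \<open>t^-n W t^n\<close> exhaust that kernel.\<close>

locale contracting = top_group +
  fixes W :: "'a set" and t :: 'a and \<eta> :: "'a \<Rightarrow> int"
  assumes W: "compact_open_subgroup G T W"
    and t [simp]: "t \<in> carrier G"
    and contracts: "conj_set G t W \<subseteq> W"
    and height_hom: "\<eta> \<in> hom G integer_group"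
    and height_t: "\<eta> t = 1"
    and height_W: "w \<in> W \<Longrightarrow> \<eta> w = 0"
    and absorb: "h \<in> carrier G \<Longrightarrow> \<eta> h = 0 \<Longrightarrow> \<exists>n::nat. conj_elt G (t [^] n) h \<in> W"
begin

definition q :: nat where "q = subgroup_index G W (conj_set G t W)"

lemma W_subgroup: "subgroup W G"
  using W by (simp add: compact_open_subgroup_def)

sublocale W: subgroup W G by (rule W_subgroup)

lemma height_mult: "x \<in> carrier G \<Longrightarrow> y \<in> carrier G \<Longrightarrow> \<eta> (x \<otimes> y) = \<eta> x + \<eta> y"
  using height_hom by (simp add: hom_def)

lemma height_one: "\<eta> \<one> = 0"
  using height_mult[of \<one> \<one>] by simp

lemma height_inv: "x \<in> carrier G \<Longrightarrow> \<eta> (inv x) = - \<eta> x"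
  using height_mult[of x "inv x"] height_one by simp

lemma height_pow: "\<eta> (t [^] (n::nat)) = int n"
  by (induction n) (auto simp: height_one height_mult height_t)

lemma q_pos: "q > 0"
  unfolding q_def by (rule subgroup_index_pos[OF W compact_open_conj[OF t W]])

text \<open>An ascending exhaustion of the kernel of \<eta> by compact open subgroups. An element of
  height 0 lies in one of them and hence normalises it.\<close>

definition enlarged :: "nat \<Rightarrow> 'a set" where
  "enlarged n = conj_set G (inv (t [^] n)) W"

lemma enlarged_compact_open: "compact_open_subgroup G T (enlarged n)"
  unfolding enlarged_def by (rule compact_open_conj[OF _ W]) simp

lemma mem_enlarged: "h \<in> carrier G \<Longrightarrow> h \<in> enlarged n \<longleftrightarrow> conj_elt G (t [^] n) h \<in> W"
  unfolding enlarged_def by (simp add: mem_conj_set_iff W.subset)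

lemma height_0_in_enlarged: "h \<in> carrier G \<Longrightarrow> \<eta> h = 0 \<Longrightarrow> \<exists>n. h \<in> enlarged n"
  using absorb mem_enlarged by blast

lemma contracts_enlarged: "conj_set G (t [^] (m::nat)) (enlarged n) \<subseteq> enlarged n"
proof (induction m)
  case 0
  then show ?case using conj_set_one[OF compact_open_subset[OF enlarged_compact_open]] by simp
next
  case (Suc m)
  have eG: "enlarged n \<subseteq> carrier G" by (rule compact_open_subset[OF enlarged_compact_open])
  have comm: "t \<otimes> inv (t [^] n) = inv (t [^] n) \<otimes> t"
  proof -
    have "t [^] n \<otimes> t = t \<otimes> t [^] n" using nat_pow_Suc2[OF t, of n] by simp
    then show ?thesis by (metis inv_solve_left inv_solve_right m_assoc m_closed nat_pow_closed t inv_closed)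
  qed
  have "conj_set G t (enlarged n) = conj_set G (inv (t [^] n)) (conj_set G t W)"
    unfolding enlarged_def by (simp add: conj_set_conj_set W.subset comm)
  also have "\<dots> \<subseteq> enlarged n" unfolding enlarged_def conj_set_eq_image[of G "inv (t [^] n)"] using contracts by blast
  finally have "conj_set G (t [^] m) (conj_set G t (enlarged n)) \<subseteq> conj_set G (t [^] m) (enlarged n)"
    unfolding conj_set_eq_image[of G "t [^] m"] by blast
  then show ?case using Suc conj_set_conj_set[OF nat_pow_closed[OF t] t eG, of m] by simp
qed

section \<open>The scale function in the presence of a contracting element\<close>

lemma scale_attained:
  "\<exists>U. compact_open_subgroup G T U \<and> group_scale G T y = subgroup_index G (conj_set G y U) (conj_set G y U \<inter> U)"
proof -
  let ?S = "{subgroup_index G (conj_set G y U) (conj_set G y U \<inter> U) | U. compact_open_subgroup G T U}"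
  have "?S \<noteq> {}" using W by blast
  then have "group_scale G T y \<in> ?S" unfolding group_scale_def by (rule Inf_nat_def1)
  then show ?thesis by blast
qed

lemma scale_le:
  "compact_open_subgroup G T U \<Longrightarrow> group_scale G T y \<le> subgroup_index G (conj_set G y U) (conj_set G y U \<inter> U)"
  unfolding group_scale_def by (rule cInf_lower) auto

text \<open>Write \<open>y = t^m h\<close> with \<open>h\<close> of height 0. An enlargement
  containing \<open>h\<close> is normalised by \<open>h\<close> and contracted by
  \<open>t^m\<close>, so \<open>y\<close> conjugates it into itself and the index is 1.\<close>

lemma scale_eq_1:
  assumes y: "y \<in> carrier G" and "\<eta> y \<ge> 0" shows "group_scale G T y = 1"
proof -
  define m where "m = nat (\<eta> y)"
  have m: "int m = \<eta> y" using assms by (simp add: m_def)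
  define h where "h = inv (t [^] m) \<otimes> y"
  have h: "h \<in> carrier G" "\<eta> h = 0" and yh: "y = t [^] m \<otimes> h"
    using y m by (auto simp: h_def height_mult height_inv height_pow mult_inv_cancel)
  obtain n where n: "h \<in> enlarged n" using height_0_in_enlarged[OF h] by blast
  have e: "subgroup (enlarged n) G" using enlarged_compact_open by (simp add: compact_open_subgroup_def)
  have "conj_set G y (enlarged n) = conj_set G (t [^] m) (enlarged n)"
    using conj_set_conj_set[OF nat_pow_closed[OF t, of m] h(1) compact_open_subset[OF enlarged_compact_open[of n]]]
      conj_set_subgroup_self[OF e n] by (simp add: yh)
  then have sub: "conj_set G y (enlarged n) \<subseteq> enlarged n" using contracts_enlarged by simp
  have "group_scale G T y \<le> 1"
    using scale_le[OF enlarged_compact_open, of y n] subgroup_index_self[OF subgroup_conj_set[OF y e]] sub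
    by (simp add: inf.absorb1)
  \<comment> \<open>The value 0 of \<open>subgroup_index\<close> stands for an infinite index, which
    compactness excludes.\<close>
  moreover have "group_scale G T y > 0"
  proof -
    obtain U where "compact_open_subgroup G T U"
      "group_scale G T y = subgroup_index G (conj_set G y U) (conj_set G y U \<inter> U)"
      using scale_attained by blast
    then show ?thesis using subgroup_index_pos compact_open_Int compact_open_conj[OF y] by metis
  qed
  ultimately show ?thesis by linarith
qed

text \<open>The ratio may be evaluated at an enlargement that contains \<open>h\<close>, and
  \<open>h\<close> normalises that one.\<close>

lemma modulus_height_0:
  assumes h: "h \<in> carrier G" "\<eta> h = 0" shows "rel_index (conj_set G h W) W = 1"
proof -
  obtain n where n: "h \<in> enlarged n" using height_0_in_enlarged[OF h] by blast
  have e: "subgroup (enlarged n) G" using enlarged_compact_open by (simp add: compact_open_subgroup_def)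
  show ?thesis
    using rel_index_conj_indep[OF h(1) W enlarged_compact_open[of n]] conj_set_subgroup_self[OF e n]
      rel_index_self[OF enlarged_compact_open] by simp
qed

lemma conj_inv_t: "W \<subseteq> conj_set G (inv t) W" "subgroup_index G (conj_set G (inv t) W) W = q"
proof -
  have eq: "conj_set G (inv t) (conj_set G t W) = W"
    by (simp add: conj_set_conj_set W.subset conj_set_one)
  show "W \<subseteq> conj_set G (inv t) W"
    using contracts unfolding conj_set_eq_image[of G "inv t"] by (subst eq[symmetric]) (auto simp: conj_set_eq_image[of G "inv t"])
  show "subgroup_index G (conj_set G (inv t) W) W = q"
    using subgroup_index_conj[of "inv t" W "conj_set G t W"] conj_set_subset[of t W] W.subset
    by (simp add: eq q_def)
qed

lemma modulus_inv_pow: "rel_index (conj_set G (inv t [^] (n::nat)) W) W = real q ^ n"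
proof (induction n)
  case 0
  then show ?case using rel_index_self[OF W] by (simp add: conj_set_one W.subset)
next
  case (Suc n)
  have "rel_index (conj_set G (inv t) W) W = q"
    using conj_inv_t subgroup_index_self[OF W_subgroup] by (simp add: rel_index_def inf.absorb2)
  then show ?case using Suc rel_index_conj_mult[OF nat_pow_closed[of "inv t" n] _ W, of "inv t"] by simp
qed

text \<open>With \<open>m = - \<eta> y > 0\<close> the modular function at \<open>y\<close> is
  \<open>q ^ m\<close>. For the minimising \<open>U\<close>, whatever it is, the scale is therefore
  \<open>q ^ m\<close> times the positive integer \<open>[U : yUy^-1 \<inter> U]\<close>.\<close>

lemma scale_ge:
  assumes y: "y \<in> carrier G" and neg: "\<eta> y < 0" shows "group_scale G T y \<ge> q"
proof -
  define m where "m = nat (- \<eta> y)"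
  have m: "int m = - \<eta> y" "m > 0" using neg by (simp_all add: m_def)
  define h where "h = t [^] m \<otimes> y"
  have ti: "inv t [^] m = inv (t [^] m)" by (simp add: nat_pow_inv)
  have h: "h \<in> carrier G" "\<eta> h = 0" and yh: "y = inv t [^] m \<otimes> h"
    using y m unfolding ti by (auto simp: h_def height_mult height_pow mult_inv_cancel)
  have mod: "rel_index (conj_set G y W) W = real q ^ m"
    using rel_index_conj_mult[OF nat_pow_closed[of "inv t" m] h(1) W] modulus_height_0[OF h] modulus_inv_pow
    by (simp add: yh)
  obtain U where U: "compact_open_subgroup G T U"
    "group_scale G T y = subgroup_index G (conj_set G y U) (conj_set G y U \<inter> U)"
    using scale_attained by blast
  note yU = compact_open_conj[OF y U(1)]
  have pos: "subgroup_index G U (conj_set G y U \<inter> U) > 0"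
    by (rule subgroup_index_pos[OF U(1) compact_open_Int[OF yU U(1)]])
  have "rel_index (conj_set G y U) U = real q ^ m"
    using rel_index_conj_indep[OF y U(1) W] mod by simp
  then have "real (group_scale G T y) = real q ^ m * real (subgroup_index G U (conj_set G y U \<inter> U))"
    using pos by (simp add: rel_index_def U(2) field_simps)
  then have "group_scale G T y = q ^ m * subgroup_index G U (conj_set G y U \<inter> U)"
    by (metis of_nat_eq_iff of_nat_mult of_nat_power)
  moreover have "q ^ 1 \<le> q ^ m" by (rule power_increasing) (use m q_pos in auto)
  ultimately show ?thesis using pos by (simp add: order_trans[of q "q ^ m"])
qed

lemma scale_inv_t: "group_scale G T (inv t) = q"
proof (rule antisym)
  show "group_scale G T (inv t) \<le> q"
    using scale_le[OF W, of "inv t"] conj_inv_t by (simp add: inf.absorb2)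
  show "group_scale G T (inv t) \<ge> q" by (rule scale_ge) (auto simp: height_inv height_t)
qed

lemma scale_min: "y \<in> carrier G \<Longrightarrow> group_scale G T y \<noteq> 1 \<Longrightarrow> q \<le> group_scale G T y"
  using scale_eq_1 scale_ge by force

section \<open>The tree of cosets\<close>

definition parent :: "'a set \<Rightarrow> 'a set" where
  "parent C = W #> (t \<otimes> (SOME c. c \<in> C))"

text \<open>The inverse turns right translation into a left action, and the restriction is there
  because the elements of \<open>Bij\<close> are extensional.\<close>

definition coset_action :: "'a \<Rightarrow> 'a set \<Rightarrow> 'a set" where
  "coset_action g = (\<lambda>C \<in> rcosets W. C #> inv g)"

lemma coset_eq_iff:
  assumes "a \<in> carrier G" "b \<in> carrier G" shows "W #> a = W #> b \<longleftrightarrow> a \<otimes> inv b \<in> W"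
  using W.rcos_module[OF is_group assms(2,1)] rcos_self[OF assms(1) W_subgroup]
    repr_independence[OF _ assms(2) W_subgroup, of a] by blast

lemma rcosetsE: assumes "C \<in> rcosets W" obtains a where "a \<in> carrier G" "C = W #> a"
  using assms by (auto simp: RCOSETS_def)

lemma coset_in_rcosets [simp]: "a \<in> carrier G \<Longrightarrow> W #> a \<in> rcosets W"
  by (auto simp: RCOSETS_def)

text \<open>The representative chosen in \<open>parent\<close> does not matter:
  \<open>t w a = (t w t^-1) t a\<close>, and \<open>t w t^-1\<close> is in \<open>W\<close> by
  contraction.\<close>

lemma parent_coset:
  assumes a: "a \<in> carrier G" shows "parent (W #> a) = W #> (t \<otimes> a)"
proof -
  define c where "c = (SOME c. c \<in> W #> a)"
  have "c \<in> W #> a" unfolding c_def by (rule someI[of _ a]) (rule rcos_self[OF a W_subgroup])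
  then obtain w where w: "w \<in> W" "c = w \<otimes> a" by (auto simp: r_coset_def)
  have "conj_elt G t w \<in> W" using contracts w by (auto simp: conj_set_eq_image)
  moreover have "t \<otimes> c \<otimes> inv (t \<otimes> a) = conj_elt G t w"
    using w a W.subset by (auto simp: conj_elt_def m_assoc inv_mult_group mult_inv_cancel)
  ultimately show ?thesis
    unfolding parent_def c_def[symmetric] using w a W.subset by (subst coset_eq_iff) auto
qed

lemma parent_funpow:
  assumes a: "a \<in> carrier G" shows "(parent ^^ n) (W #> a) = W #> (t [^] n \<otimes> a)"
proof (induction n)
  case (Suc n)
  have "t [^] Suc n \<otimes> a = t \<otimes> (t [^] n \<otimes> a)" using a nat_pow_Suc2[OF t, of n] by (simp add: m_assoc)
  then show ?case using Suc a by (simp add: parent_coset)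
qed (use a in simp)

text \<open>The map \<open>c \<mapsto> t^-1 c a\<close> takes the coset \<open>t W t^-1 w\<close> to
  \<open>W t^-1 w a\<close>. So the children of any vertex correspond to the cosets of
  \<open>t W t^-1\<close> in \<open>W\<close>, and their number is \<open>q\<close>.\<close>

lemma coset_children:
  assumes a: "a \<in> carrier G"
  shows "{C \<in> rcosets W. parent C = W #> a} = (\<lambda>C. (\<lambda>c. inv t \<otimes> c \<otimes> a) ` C) ` (\<lambda>w. conj_set G t W #> w) ` W"
proof -
  have K: "(\<lambda>c. inv t \<otimes> c \<otimes> a) ` (conj_set G t W #> w) = W #> (inv t \<otimes> w \<otimes> a)" if w: "w \<in> W" for w
  proof -
    have "inv t \<otimes> (conj_elt G t u \<otimes> w) \<otimes> a = u \<otimes> (inv t \<otimes> w \<otimes> a)" if "u \<in> W" for u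
      using that w a W.subset by (auto simp: conj_elt_def m_assoc mult_inv_cancel)
    then show ?thesis unfolding r_coset_def conj_set_eq_image by (auto simp: image_iff)
  qed
  show ?thesis
  proof (intro equalityI subsetI)
    fix C assume "C \<in> {C \<in> rcosets W. parent C = W #> a}"
    then obtain b where b: "b \<in> carrier G" "C = W #> b" "W #> (t \<otimes> b) = W #> a"
      by (auto elim!: rcosetsE simp: parent_coset)
    define w where "w = t \<otimes> b \<otimes> inv a"
    have "w \<in> W" using b a coset_eq_iff by (simp add: w_def)
    moreover have "inv t \<otimes> w \<otimes> a = b" using a b by (simp add: w_def m_assoc mult_inv_cancel)
    ultimately show "C \<in> (\<lambda>C. (\<lambda>c. inv t \<otimes> c \<otimes> a) ` C) ` (\<lambda>w. conj_set G t W #> w) ` W"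
      using K[of w] b(2) by (auto simp: image_iff intro!: bexI[of _ w])
  next
    fix C assume "C \<in> (\<lambda>C. (\<lambda>c. inv t \<otimes> c \<otimes> a) ` C) ` (\<lambda>w. conj_set G t W #> w) ` W"
    then obtain w where w: "w \<in> W" "C = W #> (inv t \<otimes> w \<otimes> a)" using K by auto
    have wG: "w \<in> carrier G" using w W.subset by blast
    have "parent C = W #> (w \<otimes> a)" using w(2) wG a by (simp add: parent_coset m_assoc mult_inv_cancel)
    also have "\<dots> = W #> a" using w(1) wG a by (subst coset_eq_iff) (auto simp: m_assoc)
    finally show "C \<in> {C \<in> rcosets W. parent C = W #> a}" using w(2) wG a by simp
  qed
qed

lemma coset_parent_tree:
  assumes q2: "q \<ge> 2" shows "parent_tree q (rcosets W) parent"
proof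
  show "rcosets W \<noteq> {}" using coset_in_rcosets[OF one_closed] by blast
  show "parent v \<in> rcosets W" if "v \<in> rcosets W" for v using that by (auto elim!: rcosetsE simp: parent_coset)
  show "card {u \<in> rcosets W. parent u = v} = q" if v: "v \<in> rcosets W" for v
  proof -
    obtain a where a: "a \<in> carrier G" "v = W #> a" using v by (rule rcosetsE)
    have "inj_on (\<lambda>C. (\<lambda>c. inv t \<otimes> c \<otimes> a) ` C) ((\<lambda>w. conj_set G t W #> w) ` W)"
    proof (rule inj_onI)
      fix C D assume CD: "C \<in> (\<lambda>w. conj_set G t W #> w) ` W" "D \<in> (\<lambda>w. conj_set G t W #> w) ` W"
        "(\<lambda>c. inv t \<otimes> c \<otimes> a) ` C = (\<lambda>c. inv t \<otimes> c \<otimes> a) ` D"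
      have "conj_set G t W #> w \<subseteq> carrier G" if "w \<in> W" for w
        by (rule r_coset_subset_G) (use that W.subset conj_set_subset[OF t W.subset] in auto)
      then have "C \<subseteq> carrier G" "D \<subseteq> carrier G" using CD by auto
      moreover have "inj_on (\<lambda>c. inv t \<otimes> c \<otimes> a) (carrier G)" using a by (auto simp: inj_on_def)
      ultimately show "C = D" using CD(3) by (simp add: inj_on_image_eq_iff)
    qed
    then show ?thesis unfolding a(2) coset_children[OF a(1)]
      by (simp add: card_image q_def subgroup_index_def rcosets_restrict)
  qed
  show "q \<ge> 2" by fact
  show "n = 0" if v: "v \<in> rcosets W" "(parent ^^ n) v = v" for v n
  proof -
    obtain a where a: "a \<in> carrier G" "v = W #> a" using v(1) by (rule rcosetsE)
    then have "t [^] n \<otimes> a \<otimes> inv a \<in> W" using v(2) coset_eq_iff parent_funpow by auto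
    then have "t [^] n \<in> W" using a(1) by (simp add: m_assoc)
    then show ?thesis using height_W height_pow by fastforce
  qed
  show "\<exists>m n. (parent ^^ m) u = (parent ^^ n) v" if u: "u \<in> rcosets W" and v: "v \<in> rcosets W" for u v
  proof -
    obtain a where a: "a \<in> carrier G" "u = W #> a" using u by (rule rcosetsE)
    obtain b where b: "b \<in> carrier G" "v = W #> b" using v by (rule rcosetsE)
    define g where "g = a \<otimes> inv b"
    have g: "g \<in> carrier G" using a b by (simp add: g_def)
    \<comment> \<open>The exponents balance heights: \<open>m - n = - \<eta> g\<close>, so
      \<open>h\<close> has height 0. If conjugation by \<open>t^N\<close> brings \<open>h\<close>
      into \<open>W\<close>, then the ancestors of \<open>u\<close> and \<open>v\<close> after
      \<open>N + m\<close> and \<open>N + n\<close> steps coincide.\<close>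
    define m where "m = nat (- \<eta> g)"
    define n where "n = nat (\<eta> g)"
    define h where "h = t [^] m \<otimes> g \<otimes> inv (t [^] n)"
    have h: "h \<in> carrier G" "\<eta> h = 0" using g by (auto simp: h_def height_mult height_inv height_pow m_def n_def)
    obtain N where N: "conj_elt G (t [^] (N::nat)) h \<in> W" using absorb[OF h] by blast
    have "t [^] (N + m) \<otimes> a \<otimes> inv (t [^] (N + n) \<otimes> b) = conj_elt G (t [^] N) h"
      using a(1) b(1)
      by (simp add: h_def g_def conj_elt_def m_assoc inv_mult_group nat_pow_mult[OF t, symmetric])
    then have "(parent ^^ (N + m)) u = (parent ^^ (N + n)) v"
      using a b N unfolding a(2) b(2) parent_funpow[OF a(1)] parent_funpow[OF b(1)]
      by (subst coset_eq_iff) auto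
    then show ?thesis by blast
  qed
qed

lemma coset_action_coset:
  "g \<in> carrier G \<Longrightarrow> a \<in> carrier G \<Longrightarrow> coset_action g (W #> a) = W #> (a \<otimes> inv g)"
  by (simp add: coset_action_def coset_mult_assoc W.subset)

lemma coset_group_action: "group_action G (rcosets W) coset_action"
proof (rule group_actionI[OF is_group])
  have in_cosets: "coset_action g C \<in> rcosets W" if "g \<in> carrier G" "C \<in> rcosets W" for g C
    using that by (auto elim!: rcosetsE simp: coset_action_coset)
  show "coset_action g \<in> Bij (rcosets W)" if g: "g \<in> carrier G" for g
  proof -
    have "bij_betw (coset_action g) (rcosets W) (rcosets W)"
      by (rule bij_betw_byWitness[where f' = "coset_action (inv g)"])
        (use g in_cosets in \<open>auto elim!: rcosetsE simp: coset_action_coset m_assoc\<close>)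
    then show ?thesis by (simp add: Bij_def coset_action_def)
  qed
  show "coset_action (g \<otimes> h) = compose (rcosets W) (coset_action g) (coset_action h)"
    if "g \<in> carrier G" "h \<in> carrier G" for g h
  proof
    fix C
    show "coset_action (g \<otimes> h) C = compose (rcosets W) (coset_action g) (coset_action h) C"
    proof (cases "C \<in> rcosets W")
      case True
      then obtain a where "a \<in> carrier G" "C = W #> a" by (rule rcosetsE)
      then show ?thesis using that True by (simp add: compose_eq coset_action_coset inv_mult_group m_assoc)
    qed (simp add: coset_action_def compose_def)
  qed
qed

text \<open>The condition \<open>a g^-1 b^-1 \<in> W\<close> becomes \<open>b g a^-1 \<in> W\<close>
  on taking inverses. So transporters are two-sided translates of \<open>W\<close>, hence compact
  and open.\<close>

lemma coset_transporter:
  assumes "a \<in> carrier G" "b \<in> carrier G"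
  shows "{g \<in> carrier G. coset_action g (W #> a) = W #> b} = (\<lambda>x. x \<otimes> a) ` (\<lambda>x. inv b \<otimes> x) ` W"
proof (intro equalityI subsetI)
  fix g assume "g \<in> {g \<in> carrier G. coset_action g (W #> a) = W #> b}"
  then have g: "g \<in> carrier G" "a \<otimes> inv g \<otimes> inv b \<in> W" using assms by (auto simp: coset_action_coset coset_eq_iff)
  then have "inv (a \<otimes> inv g \<otimes> inv b) \<in> W" by blast
  then have "b \<otimes> g \<otimes> inv a \<in> W" using g assms by (simp add: inv_mult_group m_assoc)
  then show "g \<in> (\<lambda>x. x \<otimes> a) ` (\<lambda>x. inv b \<otimes> x) ` W"
    unfolding image_image by (rule rev_image_eqI) (use g assms in \<open>simp add: m_assoc mult_inv_cancel\<close>)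
next
  fix g assume "g \<in> (\<lambda>x. x \<otimes> a) ` (\<lambda>x. inv b \<otimes> x) ` W"
  then obtain w where w: "w \<in> W" "g = inv b \<otimes> w \<otimes> a" by auto
  have wG: "w \<in> carrier G" using w W.subset by blast
  have "a \<otimes> inv g \<otimes> inv b = inv w" using w wG assms by (simp add: inv_mult_group m_assoc mult_inv_cancel)
  then show "g \<in> {g \<in> carrier G. coset_action g (W #> a) = W #> b}"
    using w wG assms by (simp add: coset_action_coset coset_eq_iff)
qed

text \<open>Faithfulness is the point: the kernel is an intersection of closed stabilisers inside
  the compact stabiliser of \<open>W\<close>, hence a compact normal subgroup.\<close>

theorem coset_tree_action:
  assumes q2: "q \<ge> 2" and nc: "no_compact_normal_subgroup G T"
  shows "tree_action q (rcosets W) parent G coset_action T"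
proof -
  have cW: "compactin T W" and oW: "openin T W" using W by (auto simp: compact_open_subgroup_def)
  have comp: "compactin T {g \<in> carrier G. coset_action g u = v}" and op: "openin T {g \<in> carrier G. coset_action g u = v}"
    if u: "u \<in> rcosets W" and v: "v \<in> rcosets W" for u v
  proof -
    obtain a where a: "a \<in> carrier G" "u = W #> a" using u by (rule rcosetsE)
    obtain b where b: "b \<in> carrier G" "v = W #> b" using v by (rule rcosetsE)
    have eq: "{g \<in> carrier G. coset_action g u = v} = (\<lambda>x. x \<otimes> a) ` (\<lambda>x. inv b \<otimes> x) ` W"
      unfolding a(2) b(2) by (rule coset_transporter[OF a(1) b(1)])
    show "compactin T {g \<in> carrier G. coset_action g u = v}"
      unfolding eq using image_compactin[OF image_compactin[OF cW continuous_left] continuous_right] a(1) b(1) by simp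
    show "openin T {g \<in> carrier G. coset_action g u = v}"
      unfolding eq using a(1) b(1) by (intro open_right_translate open_left_translate oW) auto
  qed
  interpret act: group_action G "rcosets W" coset_action by (rule coset_group_action)
  interpret hom: group_hom G "BijGroup (rcosets W)" coset_action by (rule act.group_hom)
  let ?N = "kernel G (BijGroup (rcosets W)) coset_action"
  have W1: "W \<in> rcosets W" using coset_in_rcosets[OF one_closed] by (simp add: W.subset)
  have N: "?N = (\<Inter>C\<in>rcosets W. {g \<in> carrier G. coset_action g C = C})"
  proof (intro equalityI subsetI)
    fix g assume "g \<in> ?N"
    then show "g \<in> (\<Inter>C\<in>rcosets W. {g \<in> carrier G. coset_action g C = C})"
      by (auto simp: kernel_def BijGroup_def)
  next
    fix g assume g: "g \<in> (\<Inter>C\<in>rcosets W. {g \<in> carrier G. coset_action g C = C})"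
    then have "coset_action g = (\<lambda>C\<in>rcosets W. C)" by (auto simp: coset_action_def fun_eq_iff)
    then show "g \<in> ?N" using g W1 by (auto simp: kernel_def BijGroup_def)
  qed
  have "closedin T ?N" unfolding N
    using W1 compactin_imp_closedin[OF Hausdorff comp] by (intro closedin_INT) auto
  moreover have "?N \<subseteq> {g \<in> carrier G. coset_action g W = W}" unfolding N using W1 by blast
  ultimately have "compactin T ?N" using closed_compactin comp[OF W1 W1] by blast
  then have "?N = {\<one>}" using nc hom.normal_kernel by (simp add: no_compact_normal_subgroup_def)
  then have inj: "inj_on coset_action (carrier G)" using hom.inj_iff_trivial_ker by blast
  show ?thesis
  proof (intro tree_action.intro tree_action_axioms.intro)
    show "coset_action g (parent v) = parent (coset_action g v)" if "g \<in> carrier G" "v \<in> rcosets W" for g v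
      using that by (auto elim!: rcosetsE simp: coset_action_coset parent_coset m_assoc)
    show "\<exists>g\<in>carrier G. coset_action g u = v" if u: "u \<in> rcosets W" and v: "v \<in> rcosets W" for u v
    proof -
      obtain a where a: "a \<in> carrier G" "u = W #> a" using u by (rule rcosetsE)
      obtain b where b: "b \<in> carrier G" "v = W #> b" using v by (rule rcosetsE)
      have "a \<otimes> inv (inv b \<otimes> a) = b" using a b by (simp add: inv_mult_group mult_inv_cancel)
      then have "coset_action (inv b \<otimes> a) u = v"
        using coset_action_coset[of "inv b \<otimes> a" a] a b by (simp del: hom.hom_mult hom.hom_inv)
      then show ?thesis using a b by (intro bexI[of _ "inv b \<otimes> a"]) auto
    qed
  qed (use coset_parent_tree[OF q2] coset_group_action inj comp op in auto)
qed

end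

section \<open>From conditions (1)-(3) to a contracting element\<close>

context top_group
begin

lemma compact_open_INT:
  assumes "finite J" "J \<noteq> {}" "\<And>j. j \<in> J \<Longrightarrow> compact_open_subgroup G T (U j)"
  shows "compact_open_subgroup G T (\<Inter>j\<in>J. U j)"
  using assms by (induction J rule: finite_ne_induct) (auto intro: compact_open_Int)

text \<open>The element \<open>x\<close> of condition (3) need not generate \<open>G/H\<close>; it is replaced by a generator \<open>t\<close> with
  \<open>t^k \<in> x H\<close>, and \<open>V\<close> by a finite intersection of conjugates by powers of \<open>t\<close> of an enlargement of \<open>V\<close>.\<close>

lemma conditions_imp_contracting:
  assumes cond: "scale_group_conditions G T"
  shows "\<exists>W t \<eta>. contracting G T W t \<eta> \<and> 2 \<le> subgroup_index G W (conj_set G t W)"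
proof -
  have nc: "no_compact_normal_subgroup G T" using cond by (simp add: scale_group_conditions_def)
  obtain H V x where H: "H \<lhd> G" and Hopen: "openin T H" and quot: "G Mod H \<cong> integer_group"
    and V: "compact_open_subgroup G T V" and x: "x \<in> carrier G" and xV: "conj_set G x V \<subset> V"
    and un: "(\<Union>n::int. conj_set G (x [^] n) V) = H"
    using cond by (auto simp: scale_group_conditions_def open_normal_with_quotient_Z_def ascending_union_of_conjugates_def)
  interpret H: normal H G by fact
  interpret V: subgroup V G using V by (simp add: compact_open_subgroup_def)
  have VH: "V \<subseteq> H"
  proof -
    have "conj_set G (x [^] (0::int)) V = V" by (simp add: conj_set_one V.subset)
    then show ?thesis using un by blast
  qed
  have conjH: "conj_elt G g h \<in> H" if "g \<in> carrier G" "h \<in> H" for g h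
    unfolding conj_elt_def using H.inv_op_closed2 that by blast
  obtain i where i: "i \<in> iso (G Mod H) integer_group" using quot by (auto simp: is_iso_def)
  define \<eta>0 where "\<eta>0 g = i (H #> g)" for g
  have Mod: "H #> g \<in> carrier (G Mod H)" if "g \<in> carrier G" for g
    using that by (simp add: carrier_FactGroup)
  have ih: "group_hom (G Mod H) integer_group i"
    using i H.factorgroup_is_group by (simp add: group_hom_def group_hom_axioms_def iso_def)
  have \<eta>0_hom: "\<eta>0 \<in> hom G integer_group"
  proof -
    have "\<eta>0 (a \<otimes> b) = \<eta>0 a + \<eta>0 b" if "a \<in> carrier G" "b \<in> carrier G" for a b
      using group_hom.hom_mult[OF ih Mod[OF that(1)] Mod[OF that(2)]] that
      by (simp add: \<eta>0_def H.rcos_sum)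
    then show ?thesis by (simp add: hom_def)
  qed
  have \<eta>0_ker: "\<eta>0 g = 0 \<longleftrightarrow> g \<in> H" if "g \<in> carrier G" for g
  proof -
    have "i H = 0" using group_hom.hom_one[OF ih] by simp
    moreover have "H \<in> carrier (G Mod H)" using group.is_monoid[OF H.factorgroup_is_group] monoid.one_closed by fastforce
    moreover have "inj_on i (carrier (G Mod H))" using i by (simp add: iso_def bij_betw_def)
    ultimately have "\<eta>0 g = 0 \<longleftrightarrow> H #> g = H"
      using Mod[OF that] inj_on_eq_iff[of i _ "H #> g" H] unfolding \<eta>0_def by simp
    also have "\<dots> \<longleftrightarrow> g \<in> H" using that H.subgroup_axioms coset_join1[OF _ _ ] coset_join2 by (metis H.subset)
    finally show ?thesis .
  qed
  have \<eta>0_surj: "\<exists>g\<in>carrier G. \<eta>0 g = z" for z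
  proof -
    have "z \<in> i ` carrier (G Mod H)" using i by (simp add: iso_def bij_betw_def)
    then show ?thesis by (auto simp: carrier_FactGroup \<eta>0_def)
  qed
  \<comment> \<open>Since \<open>x\<close> commutes with its powers, lying in some
    \<open>x^n V x^-n\<close> would put \<open>x\<close> into \<open>V\<close>, and then
    \<open>x V x^-1 = V\<close>.\<close>
  have xH: "x \<notin> H"
  proof
    assume "x \<in> H"
    then obtain n :: int where "x \<in> conj_set G (x [^] n) V" using un by blast
    then have "conj_elt G (inv (x [^] n)) x \<in> V" using mem_conj_set_iff x V.subset by simp
    moreover have "conj_elt G (inv (x [^] n)) x = x"
    proof -
      have "x \<otimes> x [^] n = x [^] n \<otimes> x"
        using int_pow_mult[OF x, of 1 n] int_pow_mult[OF x, of n 1] x by (simp add: add.commute int_pow_1)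
      then show ?thesis using x by (simp add: conj_elt_def m_assoc mult_inv_cancel)
    qed
    ultimately show False using conj_set_subgroup_self[OF V.subgroup_axioms, of x] xV by simp
  qed
  \<comment> \<open>The projection to the integers is determined only up to sign. The sign is chosen
    so that the contracting element \<open>x\<close> gets positive height, since the generator
    \<open>t\<close> has to contract as well.\<close>
  define \<eta> where "\<eta> g = (if \<eta>0 x > 0 then \<eta>0 g else - \<eta>0 g)" for g
  have \<eta>_hom: "\<eta> \<in> hom G integer_group" using \<eta>0_hom by (auto simp: \<eta>_def hom_def)
  have \<eta>_mult: "\<eta> (a \<otimes> b) = \<eta> a + \<eta> b" if "a \<in> carrier G" "b \<in> carrier G" for a b
    using \<eta>_hom that by (simp add: hom_def)
  have \<eta>_ker: "\<eta> g = 0 \<longleftrightarrow> g \<in> H" if "g \<in> carrier G" for g using \<eta>0_ker[OF that] by (simp add: \<eta>_def)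
  have "\<eta> x > 0" using \<eta>0_ker[OF x] xH by (simp add: \<eta>_def)
  define k where "k = nat (\<eta> x)"
  have k: "int k = \<eta> x" "k > 0" using \<open>\<eta> x > 0\<close> by (simp_all add: k_def)
  obtain t where t: "t \<in> carrier G" "\<eta> t = 1"
    using \<eta>0_surj[of 1] \<eta>0_surj[of "-1"] unfolding \<eta>_def by (cases "\<eta>0 x > 0") auto
  have \<eta>_one: "\<eta> \<one> = 0" using \<eta>_mult[of \<one> \<one>] by simp
  have \<eta>_inv: "\<eta> (inv g) = - \<eta> g" if "g \<in> carrier G" for g using \<eta>_mult[of g "inv g"] that \<eta>_one by simp
  have \<eta>_pow: "\<eta> (t [^] (n::nat)) = int n" for n
    by (induction n) (auto simp: \<eta>_one \<eta>_mult t)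
  \<comment> \<open>The power of \<open>t\<close> that has the height of \<open>x\<close>; it
    differs from \<open>x\<close> by an element \<open>h'\<close> of \<open>H\<close>.\<close>
  define y where "y = t [^] k"
  have y: "y \<in> carrier G" using t by (simp add: y_def)
  define h' where "h' = inv x \<otimes> y"
  have h': "h' \<in> H" and yx: "y = x \<otimes> h'"
    using x y \<eta>_ker[of h'] k \<eta>_pow[of k] by (auto simp: h'_def \<eta>_mult \<eta>_inv mult_inv_cancel y_def)

  \<comment> \<open>These subgroups form an ascending exhaustion of \<open>H\<close>, and
    conjugation by \<open>x\<close> takes \<open>U (Suc i)\<close> to \<open>U i\<close>.\<close>
  define U where "U i = conj_set G (inv (x [^] i)) V" for i :: nat
  have Uco: "compact_open_subgroup G T (U i)" for i unfolding U_def by (rule compact_open_conj[OF _ V]) (use x in simp)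
  have Usub: "subgroup (U i) G" for i using Uco by (simp add: compact_open_subgroup_def)
  have UG: "U i \<subseteq> carrier G" for i using Usub subgroup.subset by blast
  have memU: "g \<in> U i \<longleftrightarrow> conj_elt G (x [^] i) g \<in> V" if "g \<in> carrier G" for g i
    unfolding U_def using that x by (simp add: mem_conj_set_iff V.subset)
  have UH: "U i \<subseteq> H" for i unfolding U_def conj_set_eq_image using conjH VH x by auto
  have xstep: "conj_elt G x v \<in> V" if "v \<in> V" for v using xV that by (auto simp: conj_set_eq_image)
  have Umono1: "g \<in> U (Suc i)" if "g \<in> U i" for g i
  proof -
    have g: "g \<in> carrier G" using that UG by blast
    have "conj_elt G (x [^] Suc i) g = conj_elt G x (conj_elt G (x [^] i) g)"
      using g x nat_pow_Suc2[OF x, of i] by (simp add: conj_elt_conj_elt)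
    then show ?thesis using xstep memU[OF g] that by simp
  qed
  have Umono: "U i \<subseteq> U j" if "i \<le> j" for i j
    using that Umono1 by (induction rule: dec_induct) auto
  have Hexh: "\<exists>i. h \<in> U i" if h: "h \<in> H" for h
  proof -
    have hG: "h \<in> carrier G" using h H.subset by blast
    obtain n :: int where n: "h \<in> conj_set G (x [^] n) V" using h un by blast
    then have *: "conj_elt G (inv (x [^] n)) h \<in> V" using mem_conj_set_iff x V.subset hG by simp
    show ?thesis
    proof (cases "n \<ge> 0")
      case True
      then have "x [^] n = x [^] nat n" by (metis int_pow_int nat_0_le)
      then have "conj_elt G (inv (x [^] nat n)) h \<in> V" using * by simp
      moreover have "conj_elt G (x [^] j) v \<in> V" if "v \<in> V" for v and j :: nat
      proof -
        have v: "v \<in> carrier G" using that V.mem_carrier by blast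
        then have "v \<in> U 0" using memU[OF v, of 0] that by simp
        then have "v \<in> U j" using Umono[of 0 j] by auto
        then show ?thesis using memU[OF v, of j] by blast
      qed
      ultimately have "conj_elt G (x [^] nat n) (conj_elt G (inv (x [^] nat n)) h) \<in> V" by blast
      then have "h \<in> U 0" using memU[OF hG, of 0] x hG by simp
      then show ?thesis by blast
    next
      case False
      then have "inv (x [^] n) = x [^] nat (- n)" using x by (metis int_pow_int int_pow_neg inv_inv int_pow_closed nat_0_le minus_minus linorder_linear neg_le_0_iff_le)
      then show ?thesis using * memU[OF hG] by auto
    qed
  qed
  \<comment> \<open>From index \<open>m\<close> on, \<open>U i\<close> contains \<open>h'\<close>
    and is normalised by it. So \<open>y = x h'\<close> conjugates \<open>U (Suc i)\<close> into
    \<open>U i\<close>, as \<open>x\<close> does.\<close>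
  obtain m where m: "h' \<in> U m" using Hexh[OF h'] by blast
  have ystep: "conj_elt G y g \<in> U i" if "i \<ge> m" "g \<in> U (Suc i)" for i g
  proof -
    have g: "g \<in> carrier G" using that UG by blast
    have h'G: "h' \<in> carrier G" using h' H.subset by blast
    have "h' \<in> U (Suc i)" using m Umono[of m "Suc i"] that(1) by auto
    then have "conj_elt G h' g \<in> U (Suc i)"
      using conj_set_subgroup_self[OF Usub[of "Suc i"], of h'] that(2) by (auto simp: conj_set_eq_image)
    then have "conj_elt G (x [^] Suc i) (conj_elt G h' g) \<in> V" using memU g h'G by simp
    moreover have "conj_elt G (x [^] Suc i) (conj_elt G h' g) = conj_elt G (x [^] i) (conj_elt G y g)"
      using g h'G x y yx by (simp add: conj_elt_conj_elt m_assoc)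
    ultimately show ?thesis using memU g y by simp
  qed
  have yU: "conj_elt G y g \<in> U m" if "g \<in> U m" for g using ystep[of m g] Umono1 that by blast
  have yU_pow: "conj_elt G (y [^] n) g \<in> U m" if "g \<in> U (m + d)" "n \<ge> d" for n d :: nat and g
    using that
  proof (induction n arbitrary: d g)
    case 0
    then have "g \<in> carrier G" "d = 0" using UG by auto
    then show ?case using 0 by simp
  next
    case (Suc n)
    have g: "g \<in> carrier G" using Suc.prems UG by blast
    have eq: "conj_elt G (y [^] Suc n) g = conj_elt G (y [^] n) (conj_elt G y g)"
      using g y by (simp add: conj_elt_conj_elt)
    show ?case
    proof (cases d)
      case 0
      then show ?thesis using Suc.IH[of "conj_elt G y g" 0] Suc.prems yU eq by simp
    next
      case (Suc d')
      then show ?thesis using Suc.IH[of "conj_elt G y g" d'] Suc.prems ystep[of "m + d'" g] eq by simp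
    qed
  qed
  have ev: "\<forall>\<^sub>F n in sequentially. conj_elt G (y [^] n) h \<in> U m" if h: "h \<in> H" for h
  proof -
    obtain i where "h \<in> U i" using Hexh[OF h] by blast
    then have "h \<in> U (m + i)" using Umono[of i "m + i"] by auto
    then show ?thesis using yU_pow by (auto simp: eventually_sequentially)
  qed

  \<comment> \<open>So far only \<open>y = t^k\<close> is known to conjugate \<open>U m\<close> into
    itself. With the intersection over \<open>j < k\<close>, conjugation by \<open>t\<close> shifts
    condition \<open>j\<close> to \<open>j + 1\<close>, and the condition at \<open>k\<close> that
    comes in last holds because of \<open>y\<close>.\<close>
  define W where "W = (\<Inter>j\<in>{..<k}. conj_set G (inv (t [^] j)) (U m))"
  have Wco: "compact_open_subgroup G T W" unfolding W_def
    by (rule compact_open_INT) (use k(2) t in \<open>auto intro: compact_open_conj[OF _ Uco]\<close>)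
  have WG: "W \<subseteq> carrier G" by (rule compact_open_subset[OF Wco])
  have memW: "g \<in> W \<longleftrightarrow> (\<forall>j<k. conj_elt G (t [^] j) g \<in> U m)" if "g \<in> carrier G" for g
    unfolding W_def using that t by (auto simp: mem_conj_set_iff UG)
  have WU: "W \<subseteq> U m"
  proof
    fix w assume "w \<in> W"
    then show "w \<in> U m" using memW[of w] WG k(2) by force
  qed
  have tW: "conj_elt G t w \<in> W" if w: "w \<in> W" for w
  proof -
    have wG: "w \<in> carrier G" using w WG by blast
    have "conj_elt G (t [^] j) (conj_elt G t w) \<in> U m" if "j < k" for j
    proof -
      have eq: "conj_elt G (t [^] j) (conj_elt G t w) = conj_elt G (t [^] Suc j) w"
        using wG t by (simp add: conj_elt_conj_elt)
      show ?thesis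
      proof (cases "Suc j < k")
        case True
        then show ?thesis unfolding eq using memW[OF wG] w by blast
      next
        case False
        then have "Suc j = k" using that by linarith
        then have "t [^] Suc j = y" unfolding y_def by (rule arg_cong)
        then show ?thesis unfolding eq using yU WU w by (simp only: subset_iff)
      qed
    qed
    then show ?thesis using memW wG t by simp
  qed
  \<comment> \<open>The finitely many elements \<open>t^j h t^-j\<close> with \<open>j < k\<close>
    are all in \<open>H\<close>, so a common power \<open>y^n\<close> conjugates them into
    \<open>U m\<close>; the exponent for \<open>t\<close> is then \<open>k n\<close>.\<close>
  have absorb: "\<exists>n::nat. conj_elt G (t [^] n) h \<in> W" if h: "h \<in> H" for h
  proof -
    have hG: "h \<in> carrier G" using h H.subset by blast
    have "\<forall>\<^sub>F n in sequentially. \<forall>j\<in>{..<k}. conj_elt G (y [^] n) (conj_elt G (t [^] j) h) \<in> U m"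
      by (rule eventually_ball_finite) (use ev conjH[OF _ h] t in auto)
    then obtain n :: nat where n: "\<And>j. j < k \<Longrightarrow> conj_elt G (y [^] n) (conj_elt G (t [^] j) h) \<in> U m"
      unfolding eventually_sequentially by (metis lessThan_iff order_refl)
    have "conj_elt G (t [^] j) (conj_elt G (t [^] (k * n)) h) = conj_elt G (y [^] n) (conj_elt G (t [^] j) h)" for j :: nat
      using hG t by (simp add: conj_elt_conj_elt y_def nat_pow_pow nat_pow_mult add.commute)
    then have "conj_elt G (t [^] (k * n)) h \<in> W" using memW n hG t by simp
    then show ?thesis by blast
  qed
  have WH: "W \<subseteq> H" using WU UH by blast
  have contr: "contracting G T W t \<eta>"
  proof (intro contracting.intro contracting_axioms.intro)
    show "top_group G T" by (rule top_group_axioms)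
    show "conj_set G t W \<subseteq> W" using tW by (auto simp: conj_set_eq_image)
    show "\<eta> w = 0" if "w \<in> W" for w using that WH H.subset \<eta>_ker by blast
    show "\<exists>n::nat. conj_elt G (t [^] n) h \<in> W" if "h \<in> carrier G" "\<eta> h = 0" for h
      using absorb \<eta>_ker that by blast
  qed (use Wco t \<eta>_hom in auto)
  \<comment> \<open>With index 1, membership in \<open>W\<close> is invariant under conjugation by
    \<open>t\<close> in both directions, so absorption gives \<open>H \<subseteq> W\<close>. Then
    \<open>H\<close> is compact and normal, hence trivial, and \<open>V\<close> would be trivial as
    well, contrary to the proper inclusion.\<close>
  have "subgroup_index G W (conj_set G t W) \<noteq> 1"
  proof
    assume 1: "subgroup_index G W (conj_set G t W) = 1"
    have sW: "subgroup W G" using Wco by (simp add: compact_open_subgroup_def)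
    have "W = conj_set G t W"
      by (rule subgroup_index_eq_1_imp[OF sW subgroup_conj_set[OF t(1) sW] _ 1]) (use tW in \<open>auto simp: conj_set_eq_image\<close>)
    then have tW': "conj_elt G t g \<in> W \<longleftrightarrow> g \<in> W" if "g \<in> carrier G" for g
      using mem_conj_set_iff[OF t(1) WG, of "conj_elt G t g"] that t(1) by simp
    have "g \<in> W" if "conj_elt G (t [^] (n::nat)) g \<in> W" "g \<in> carrier G" for n g
      using that
    proof (induction n arbitrary: g)
      case (Suc n)
      have "conj_elt G (t [^] n) (conj_elt G t g) = conj_elt G (t [^] Suc n) g"
        using conj_elt_conj_elt[OF nat_pow_closed[OF t(1), of n] t(1) Suc.prems(2)] by simp
      then have "conj_elt G (t [^] n) (conj_elt G t g) \<in> W" using Suc.prems(1) by (simp only:)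
      then have "conj_elt G t g \<in> W" using Suc.IH conj_elt_closed[OF t(1) Suc.prems(2)] by blast
      then show ?case using tW'[OF Suc.prems(2)] by blast
    qed simp
    then have "H \<subseteq> W" using absorb H.subset by blast
    then have "compactin T H" using WH Wco by (simp add: compact_open_subgroup_def subset_antisym)
    then have "H = {\<one>}" using nc H by (simp add: no_compact_normal_subgroup_def)
    then have "V = {\<one>}" using VH V.one_closed by auto
    then have "conj_set G x V = V" using x by (simp add: conj_set_def)
    then show False using xV by blast
  qed
  moreover have "subgroup_index G W (conj_set G t W) > 0"
    by (rule subgroup_index_pos[OF Wco compact_open_conj[OF t(1) Wco]])
  ultimately show ?thesis using contr by (intro exI[of _ W] exI[of _ t] exI[of _ \<eta>]) auto
qed

end

section \<open>Both directions for given trees and ends\<close>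

lemma top_groupI: "locally_compact_group G T \<Longrightarrow> top_group G T"
  by (simp add: locally_compact_group_def topological_group_def top_group_def top_group_axioms_def)

text \<open>The minimum is expressed by membership and a lower bound, so the existence of an element
  of scale different from 1 is part of the claim.\<close>

theorem corollary4p2:
  fixes G :: "('a, 'm) monoid_scheme" and T :: "'a topology"
    and V :: "nat \<Rightarrow> 'v set" and E :: "nat \<Rightarrow> 'v rel" and \<omega> :: "nat \<Rightarrow> (nat \<Rightarrow> 'v) set"
  assumes trees: "\<And>q. q \<ge> 2 \<Longrightarrow> regular_tree (q + 1) (V q) (E q)"
    and ends: "\<And>q. q \<ge> 2 \<Longrightarrow> \<omega> q \<in> ends (V q) (E q)"
    and G: "locally_compact_group G T"
  shows "((\<exists>q\<ge>2. isomorphic_to_scale_group G T (V q) (E q) (\<omega> q)) \<longleftrightarrow>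
            scale_group_conditions G T) \<and>
         (scale_group_conditions G T \<longrightarrow>
            (\<exists>q\<ge>2. q \<in> {group_scale G T y | y. y \<in> carrier G \<and> group_scale G T y \<noteq> 1} \<and>
                   (\<forall>n \<in> {group_scale G T y | y. y \<in> carrier G \<and> group_scale G T y \<noteq> 1}. q \<le> n) \<and>
                   isomorphic_to_scale_group G T (V q) (E q) (\<omega> q)))"
proof -
  interpret top_group G T using G by (rule top_groupI)
  have 1: "scale_group_conditions G T"
    if q: "q \<ge> 2" and iso: "isomorphic_to_scale_group G T (V q) (E q) (\<omega> q)" for q
  proof -
    obtain p where p: "parent_tree q (V q) p"
      "Isom_end (V q) (E q) (\<omega> q) = {g \<in> Bij (V q). \<forall>v\<in>V q. g (p v) = p (g v)}"
      using regular_tree_parent_map[OF trees[OF q] ends[OF q] q] .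
    obtain \<phi> where "tree_action q (V q) p G \<phi> T"
      using parent_tree.scale_group_tree_action[OF p is_group topspace iso] by blast
    then show ?thesis by (rule tree_action.conditions)
  qed
  have 2: "\<exists>q\<ge>2. q \<in> {group_scale G T y | y. y \<in> carrier G \<and> group_scale G T y \<noteq> 1} \<and>
                   (\<forall>n \<in> {group_scale G T y | y. y \<in> carrier G \<and> group_scale G T y \<noteq> 1}. q \<le> n) \<and>
                   isomorphic_to_scale_group G T (V q) (E q) (\<omega> q)"
    if cond: "scale_group_conditions G T"
  proof -
    obtain W t \<eta> where c: "contracting G T W t \<eta>" and idx: "2 \<le> subgroup_index G W (conj_set G t W)"
      using conditions_imp_contracting[OF cond] by blast
    interpret c: contracting G T W t \<eta> by fact
    have q: "c.q \<ge> 2" using idx by (simp add: c.q_def)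
    obtain p where p: "parent_tree c.q (V c.q) p"
      "Isom_end (V c.q) (E c.q) (\<omega> c.q) = {g \<in> Bij (V c.q). \<forall>v\<in>V c.q. g (p v) = p (g v)}"
      using regular_tree_parent_map[OF trees[OF q] ends[OF q] q] .
    have "no_compact_normal_subgroup G T" using cond by (simp add: scale_group_conditions_def)
    then obtain \<psi> where "tree_action c.q (V c.q) p G \<psi> T"
      using tree_action_transport[OF c.coset_tree_action[OF q] p(1)] by blast
    then have iso: "isomorphic_to_scale_group G T (V c.q) (E c.q) (\<omega> c.q)"
      using tree_action.isomorphic_to_scale_groupI[OF _ p(2) topspace] by blast
    have "c.q \<in> {group_scale G T y | y. y \<in> carrier G \<and> group_scale G T y \<noteq> 1}"
    proof -
      have "c.q = group_scale G T (inv\<^bsub>G\<^esub> t)" "inv\<^bsub>G\<^esub> t \<in> carrier G" "group_scale G T (inv\<^bsub>G\<^esub> t) \<noteq> 1"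
        using c.scale_inv_t q c.t by simp_all
      then show ?thesis by blast
    qed
    moreover have "\<forall>n \<in> {group_scale G T y | y. y \<in> carrier G \<and> group_scale G T y \<noteq> 1}. c.q \<le> n"
      using c.scale_min by auto
    ultimately show ?thesis using q iso by blast
  qed
  show ?thesis using 1 2 by blast
qed

end
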